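(* Let $N\ge 0$ be an integer and fix $\pi^*\in\mathcal P(\mathbb X)$. Consider the POMDP, the finite-window belief-MDP with optimal value function $J^*_\beta:\hat{\mathcal Z}\to\mathbb R$, and the approximate finite model (in which the first coordinate is replaced by $\pi^*$) with optimal value function extended to $\tilde J^N_\beta:\hat{\mathcal Z}\to\mathbb R$, all as defined in the context. Let $\hat z_0=(\pi_0^-,I_0^N)$, where $\pi_0^-\in\mathcal P(\mathbb X)$ is the prior of $X_0$ and a policy $\hat\gamma$ acts on the first $N$ steps of the process, which produces $I_0^N=(Y_{[0,N]},U_{[0,N-1]})$. Then $$E^{\hat\gamma}_{\pi_0^-}\Big[\big|\tilde J^N_\beta(\hat z_0)-J^*_\beta(\hat z_0)\big|\ \Big|\ I_0^N\Big]\le \frac{\|c\|_\infty}{1-\beta}\sum_{t=0}^\infty \beta^t L_t ,$$ where $$L_t=\sup_{\hat\gamma\in\hat\Gamma}E_{\pi_0^-}^{\hat\gamma}\Big[\big\|P^{\pi_t^-}(X_{t+N}\in\cdot\,|\,Y_{[t,t+N]},U_{[t,t+N-1]})-P^{\pi^*}(X_{t+N}\in\cdot\,|\,Y_{[t,t+N]},U_{[t,t+N-1]})\big\|_{TV}\Big].$$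
   Context: POMDP: $\mathbb X\subset\mathbb R^m$ is a Borel set (state space), $\mathbb Y$ and $\mathbb U$ are finite sets (observations, actions), $\mathcal T(dx'|x,u)$ is a stochastic kernel from $\mathbb X\times\mathbb U$ to $\mathbb X$, $O(y|x)$ a stochastic kernel from $\mathbb X$ to $\mathbb Y$, $c:\mathbb X\times\mathbb U\to\mathbb R$ is bounded measurable, $\beta\in(0,1)$. Dynamics: $X_0\sim\pi_0^-$, $X_{t+1}\sim\mathcal T(\cdot|X_t,U_t)$, $Y_t\sim O(\cdot|X_t)$. $\mathcal P(\mathbb X)$ is the set of Borel probability measures, and $\|\mu-\nu\|_{TV}=\sup_{\|f\|_\infty\le1}|\int f\,d\mu-\int f\,d\nu|$. Conditional laws: for $\pi\in\mathcal P(\mathbb X)$, $P^{\pi}$ denotes conditional laws when the state at the beginning of the window has prior $\pi$. Explicitly, let $B(\pi,y)(A)=\int_A O(y|x)\pi(dx)/\int O(y|x)\pi(dx)$ (equal to an arbitrary fixed probability measure if the denominator is $0$). Then $P^\pi(X_0\in\cdot|y_0)=B(\pi,y_0)$; $P^\pi(X_{k+1}\in\cdot|y_{[0,k+1]},u_{[0,k]})=B\big(\int\mathcal T(\cdot|x,u_k)P^\pi(dx|y_{[0,k]},u_{[0,k-1]}),\,y_{k+1}\big)$; and $P^\pi(y_{k+1}|y_{[0,k]},u_{[0,k]})=\int\int O(y_{k+1}|x')\mathcal T(dx'|x,u_k)P^\pi(dx|y_{[0,k]},u_{[0,k-1]})$. In $P^{\pi}(X_{t+N}\in\cdot|Y_{[t,t+N]},U_{[t,t+N-1]})$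 the prior $\pi$ is that of $X_t$, i.e. the same formulas are used with time shifted by $t$. Set $G(\pi,y,u)=\int\mathcal T(\cdot|x,u)B(\pi,y)(dx)$. The predictor process is $\pi_{t+1}^-=G(\pi_t^-,Y_t,U_t)$, i.e. the conditional law of $X_{t+1}$ given $Y_{[0,t]},U_{[0,t]}$. Finite-window belief-MDP: state space $\hat{\mathcal Z}=\mathcal P(\mathbb X)\times\mathbb Y^{N+1}\times\mathbb U^N$, with states $\hat z_t=(\pi_t^-,Y_{[t,t+N]},U_{[t,t+N-1]})$ and action $U_{t+N}$; cost $\hat c(\pi,y_{[0,N]},u_{[0,N-1]},u)=\int c(x,u)P^\pi(X_N\in dx|y_{[0,N]},u_{[0,N-1]})$. Its optimal discounted value function $J^*_\beta$ is the bounded solution of $$J^*_\beta(\pi,y_{[0,N]},u_{[0,N-1]})=\min_{u_N\in\mathbb U}\Big(\hat c(\pi,y_{[0,N]},u_{[0,N-1]},u_N)+\beta\sum_{y_{N+1}\in\mathbb Y}J^*_\beta\big(G(\pi,y_0,u_0),y_{[1,N+1]},u_{[1,N]}\big)P^\pi(y_{N+1}|y_{[0,N]},u_{[0,N]})\Big).$$ Approximate model: finite state space $\{\pi^*\}\times\mathbb Y^{N+1}\times\mathbb U^N$, with value function $J^N_\beta$ solving $$J^N_\beta(\pi^*,y_{[0,N]},u_{[0,N-1]})=\min_{u_N\in\mathbb U}\Big(\hat c(\pi^*,y_{[0,N]},u_{[0,N-1]},u_N)+\beta\sum_{y_{N+1}\in\mathbb Y}J^N_\beta(\pi^*,y_{[1,N+1]},u_{[1,N]})P^{\pi^*}(y_{N+1}|y_{[0,N]},u_{[0,N]})\Big).$$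 It is extended to $\hat{\mathcal Z}$ by $\tilde J^N_\beta(\pi,y_{[0,N]},u_{[0,N-1]})=J^N_\beta(\pi^*,y_{[0,N]},u_{[0,N-1]})$. Policies: $\hat\Gamma$ is the set of policies which choose the first $N$ actions $U_0,\dots,U_{N-1}$ as functions of the history of observations and actions available at that time, and afterwards choose $U_{t+N}$ ($t\ge0$) as a measurable function of $(\hat z_0,\dots,\hat z_t)$. $E^{\hat\gamma}_{\pi_0^-}$ is expectation under the true dynamics with $X_0\sim\pi_0^-$ and policy $\hat\gamma$.
   Formalization: The conditional expectation given I_0^N on the left is replaced by the expectation over the random I_0^N produced by the prior and the policy; the pathwise bound is false, since L_t averages over I_0^N and the error can be large on an event of small probability. *)

theory Defs
  imports "HOL-Probability.Probability"
begin

text \<open>\<open>fallback\<close> is the arbitrary probability measure returned by Bayes' rule when the observed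
  symbol has probability zero.\<close>

record ('x, 'y, 'u) pomdp =
  St :: "'x set"
  Tr :: "'x \<Rightarrow> 'u \<Rightarrow> 'x measure"
  Ob :: "'x \<Rightarrow> 'y measure"
  cost :: "'x \<Rightarrow> 'u \<Rightarrow> real"
  disc :: real
  fallback :: "'x measure"

definition SX :: "('x::topological_space, 'y, 'u) pomdp \<Rightarrow> 'x measure" where
  "SX P = restrict_space borel (St P)"

definition probs :: "('x::topological_space, 'y, 'u) pomdp \<Rightarrow> 'x measure set" where
  "probs P = space (prob_algebra (SX P))"

definition is_pomdp :: "('x::topological_space, 'y::finite, 'u::finite) pomdp \<Rightarrow> bool" where
  "is_pomdp P \<longleftrightarrow>
     St P \<in> sets borel \<and>
     (\<lambda>(x, u). Tr P x u) \<in> SX P \<Otimes>\<^sub>M count_space UNIV \<rightarrow>\<^sub>M prob_algebra (SX P) \<and>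
     Ob P \<in> SX P \<rightarrow>\<^sub>M prob_algebra (count_space UNIV) \<and>
     (\<lambda>(x, u). cost P x u) \<in> borel_measurable (SX P \<Otimes>\<^sub>M count_space UNIV) \<and>
     (\<exists>K. \<forall>x\<in>St P. \<forall>u. \<bar>cost P x u\<bar> \<le> K) \<and>
     0 < disc P \<and> disc P < 1 \<and>
     fallback P \<in> probs P"

definition cost_norm :: "('x, 'y, 'u) pomdp \<Rightarrow> real" where
  "cost_norm P = (SUP (x, u)\<in>St P \<times> UNIV. \<bar>cost P x u\<bar>)"

text \<open>Not halved: two mutually singular probability measures have distance 2.\<close>

definition tv :: "'x measure \<Rightarrow> 'x measure \<Rightarrow> 'x measure \<Rightarrow> real" where
  "tv M \<mu> \<nu> =
     (SUP f\<in>{f \<in> borel_measurable M. \<forall>x\<in>space M. \<bar>f x\<bar> \<le> (1::real)}.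
        \<bar>(\<integral>x. f x \<partial>\<mu>) - (\<integral>x. f x \<partial>\<nu>)\<bar>)"

definition obs_lik :: "('x, 'y, 'u) pomdp \<Rightarrow> 'y \<Rightarrow> 'x \<Rightarrow> real" where
  "obs_lik P y x = measure (Ob P x) {y}"

definition bayes :: "('x, 'y, 'u) pomdp \<Rightarrow> 'x measure \<Rightarrow> 'y \<Rightarrow> 'x measure" where
  "bayes P \<pi> y =
     (let d = (\<integral>x. obs_lik P y x \<partial>\<pi>)
      in if d = 0 then fallback P else density \<pi> (\<lambda>x. ennreal (obs_lik P y x / d)))"

text \<open>
  \<open>filt P \<pi> y u k\<close> is the conditional law of the state at time \<open>k\<close> given \<open>y 0, \<dots>, y k\<close> and
  \<open>u 0, \<dots>, u (k - 1)\<close> when the state at time 0 has prior \<open>\<pi>\<close>; \<open>obs_pred P \<pi> y u k y'\<close> is the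
  conditional probability that the observation at time \<open>k + 1\<close> is \<open>y'\<close> given \<open>y 0, \<dots>, y k\<close> and
  \<open>u 0, \<dots>, u k\<close>. Later entries of the sequences \<open>y\<close>, \<open>u\<close> are irrelevant, so finite windows can
  be passed as \<^term>\<open>nth ys\<close>, \<^term>\<open>nth us\<close>.
\<close>

primrec filt :: "('x, 'y, 'u) pomdp \<Rightarrow> 'x measure \<Rightarrow> (nat \<Rightarrow> 'y) \<Rightarrow> (nat \<Rightarrow> 'u) \<Rightarrow> nat \<Rightarrow> 'x measure" where
  "filt P \<pi> y u 0 = bayes P \<pi> (y 0)"
| "filt P \<pi> y u (Suc k) = bayes P (filt P \<pi> y u k \<bind> (\<lambda>x. Tr P x (u k))) (y (Suc k))"

definition obs_pred ::
    "('x, 'y, 'u) pomdp \<Rightarrow> 'x measure \<Rightarrow> (nat \<Rightarrow> 'y) \<Rightarrow> (nat \<Rightarrow> 'u) \<Rightarrow> nat \<Rightarrow> 'y \<Rightarrow> real" where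
  "obs_pred P \<pi> y u k y' =
     (\<integral>x. (\<integral>x'. obs_lik P y' x' \<partial>(Tr P x (u k))) \<partial>(filt P \<pi> y u k))"

definition predict :: "('x, 'y, 'u) pomdp \<Rightarrow> 'x measure \<Rightarrow> 'y \<Rightarrow> 'u \<Rightarrow> 'x measure" where
  "predict P \<pi> y u = bayes P \<pi> y \<bind> (\<lambda>x. Tr P x u)"

primrec predictor ::
    "('x, 'y, 'u) pomdp \<Rightarrow> 'x measure \<Rightarrow> (nat \<Rightarrow> 'y) \<Rightarrow> (nat \<Rightarrow> 'u) \<Rightarrow> nat \<Rightarrow> 'x measure" where
  "predictor P \<pi> y u 0 = \<pi>"
| "predictor P \<pi> y u (Suc t) = predict P (predictor P \<pi> y u t) (y t) (u t)"

text \<open>A state \<open>(\<pi>, ys, us)\<close> consists of the predictor at the start of the window, the \<open>N + 1\<close>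
  observations and the \<open>N\<close> actions in the window, both in chronological order.\<close>

type_synonym ('x, 'y, 'u) zstate = "'x measure \<times> 'y list \<times> 'u list"

text \<open>\<^const>\<open>prob_algebra\<close> carries the \<open>\<sigma>\<close>-algebra generated by the evaluations \<open>\<mu> \<mapsto> \<mu>(A)\<close>, which on
  probability measures over a Borel subset of a Euclidean space is the Borel \<open>\<sigma>\<close>-algebra of
  weak convergence.\<close>

definition Zhat :: "nat \<Rightarrow> ('x::topological_space, 'y, 'u) pomdp \<Rightarrow> ('x, 'y, 'u) zstate measure" where
  "Zhat N P = prob_algebra (SX P) \<Otimes>\<^sub>M
     (count_space {ys. length ys = N + 1} \<Otimes>\<^sub>M count_space {us. length us = N})"

definition posterior :: "nat \<Rightarrow> ('x, 'y, 'u) pomdp \<Rightarrow> ('x, 'y, 'u) zstate \<Rightarrow> 'x measure" where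
  "posterior N P = (\<lambda>(\<pi>, ys, us). filt P \<pi> (nth ys) (nth us) N)"

definition cost_hat :: "nat \<Rightarrow> ('x, 'y, 'u) pomdp \<Rightarrow> ('x, 'y, 'u) zstate \<Rightarrow> 'u \<Rightarrow> real" where
  "cost_hat N P z u = (\<integral>x. cost P x u \<partial>(posterior N P z))"

definition next_obs :: "nat \<Rightarrow> ('x, 'y, 'u) pomdp \<Rightarrow> ('x, 'y, 'u) zstate \<Rightarrow> 'u \<Rightarrow> 'y \<Rightarrow> real" where
  "next_obs N P = (\<lambda>(\<pi>, ys, us) u y'. obs_pred P \<pi> (nth ys) (nth (us @ [u])) N y')"

text \<open>The action \<open>u\<close> is appended before the oldest one is dropped, so that for \<open>N = 0\<close> the oldest
  action \<^term>\<open>hd (us @ [u])\<close> is \<open>u\<close> itself.\<close>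

definition is_value_function ::
    "nat \<Rightarrow> ('x::topological_space, 'y::finite, 'u::finite) pomdp \<Rightarrow> (('x, 'y, 'u) zstate \<Rightarrow> real) \<Rightarrow> bool" where
  "is_value_function N P J \<longleftrightarrow>
     (\<exists>K. \<forall>z\<in>space (Zhat N P). \<bar>J z\<bar> \<le> K) \<and>
     (\<forall>\<pi> ys us. (\<pi>, ys, us) \<in> space (Zhat N P) \<longrightarrow>
        J (\<pi>, ys, us) =
          (MIN u\<in>UNIV. cost_hat N P (\<pi>, ys, us) u
             + disc P * (\<Sum>y'\<in>UNIV.
                 J (predict P \<pi> (hd ys) (hd (us @ [u])), tl (ys @ [y']), tl (us @ [u]))
                   * next_obs N P (\<pi>, ys, us) u y')))"

definition is_approx_value_function ::
    "nat \<Rightarrow> ('x::topological_space, 'y::finite, 'u::finite) pomdp \<Rightarrow> 'x measure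
      \<Rightarrow> (('x, 'y, 'u) zstate \<Rightarrow> real) \<Rightarrow> bool" where
  "is_approx_value_function N P \<pi>s J \<longleftrightarrow>
     (\<forall>ys us. length ys = N + 1 \<longrightarrow> length us = N \<longrightarrow>
        J (\<pi>s, ys, us) =
          (MIN u\<in>UNIV. cost_hat N P (\<pi>s, ys, us) u
             + disc P * (\<Sum>y'\<in>UNIV.
                 J (\<pi>s, tl (ys @ [y']), tl (us @ [u])) * next_obs N P (\<pi>s, ys, us) u y')))"

definition extend_value :: "'x measure \<Rightarrow> (('x, 'y, 'u) zstate \<Rightarrow> real) \<Rightarrow> ('x, 'y, 'u) zstate \<Rightarrow> real" where
  "extend_value \<pi>s J = (\<lambda>(\<pi>, ys, us). J (\<pi>s, ys, us))"

text \<open>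
  A policy is a pair \<open>(\<eta>, \<kappa>)\<close>: \<open>\<eta>\<close> maps the observations and actions so far to the action, at times
  before \<open>N\<close>; \<open>\<kappa> t\<close> maps the states number \<open>0, \<dots>, t\<close> of the belief-MDP to the action at time \<open>t + N\<close>.
\<close>

type_synonym ('x, 'y, 'u) policy =
  "('y list \<Rightarrow> 'u list \<Rightarrow> 'u) \<times> (nat \<Rightarrow> (nat \<Rightarrow> ('x, 'y, 'u) zstate) \<Rightarrow> 'u)"

definition policies :: "nat \<Rightarrow> ('x::topological_space, 'y, 'u) pomdp \<Rightarrow> ('x, 'y, 'u) policy set" where
  "policies N P =
     {(\<eta>, \<kappa>). \<forall>t. \<kappa> t \<in> (\<Pi>\<^sub>M i\<in>{..t}. Zhat N P) \<rightarrow>\<^sub>M count_space UNIV}"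

definition zhat ::
    "nat \<Rightarrow> ('x, 'y, 'u) pomdp \<Rightarrow> 'x measure \<Rightarrow> 'y list \<Rightarrow> 'u list \<Rightarrow> nat \<Rightarrow> ('x, 'y, 'u) zstate" where
  "zhat N P \<pi>0 ys us t =
     (predictor P \<pi>0 (nth ys) (nth us) t, take (N + 1) (drop t ys), take N (drop t us))"

text \<open>The action taken at time \<^term>\<open>length us\<close> after observing \<open>ys\<close> and having taken \<open>us\<close>.\<close>

definition act ::
    "nat \<Rightarrow> ('x, 'y, 'u) pomdp \<Rightarrow> 'x measure \<Rightarrow> ('x, 'y, 'u) policy \<Rightarrow> 'y list \<Rightarrow> 'u list \<Rightarrow> 'u" where
  "act N P \<pi>0 = (\<lambda>(\<eta>, \<kappa>) ys us.
     if length us < N then \<eta> ys us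
     else \<kappa> (length us - N) (\<lambda>i\<in>{..length us - N}. zhat N P \<pi>0 ys us i))"

definition Hist :: "('x::topological_space, 'y, 'u) pomdp \<Rightarrow> ('x \<times> 'y list \<times> 'u list) measure" where
  "Hist P = SX P \<Otimes>\<^sub>M (count_space UNIV \<Otimes>\<^sub>M count_space UNIV)"

text \<open>\<open>law N P \<pi>0 \<gamma> n\<close> is the joint law of the state at time \<open>n\<close>, the observations up to time \<open>n\<close>
  and the actions up to time \<open>n - 1\<close> when the initial state has law \<open>\<pi>0\<close> and \<open>\<gamma>\<close> is used.\<close>

primrec law ::
    "nat \<Rightarrow> ('x::topological_space, 'y, 'u) pomdp \<Rightarrow> 'x measure \<Rightarrow> ('x, 'y, 'u) policy \<Rightarrow> nat
      \<Rightarrow> ('x \<times> 'y list \<times> 'u list) measure" where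
  "law N P \<pi>0 \<gamma> 0 = \<pi>0 \<bind> (\<lambda>x. Ob P x \<bind> (\<lambda>y. return (Hist P) (x, [y], [])))"
| "law N P \<pi>0 \<gamma> (Suc n) = law N P \<pi>0 \<gamma> n \<bind> (\<lambda>(x, ys, us).
     Tr P x (act N P \<pi>0 \<gamma> ys us) \<bind> (\<lambda>x'.
       Ob P x' \<bind> (\<lambda>y'. return (Hist P) (x', ys @ [y'], us @ [act N P \<pi>0 \<gamma> ys us]))))"

definition expect ::
    "nat \<Rightarrow> ('x::topological_space, 'y, 'u) pomdp \<Rightarrow> 'x measure \<Rightarrow> ('x, 'y, 'u) policy \<Rightarrow> nat
      \<Rightarrow> ('y list \<Rightarrow> 'u list \<Rightarrow> real) \<Rightarrow> real" where
  "expect N P \<pi>0 \<gamma> n f = (\<integral>(x, ys, us). f ys us \<partial>(law N P \<pi>0 \<gamma> n))"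

definition filter_err ::
    "nat \<Rightarrow> ('x::topological_space, 'y, 'u) pomdp \<Rightarrow> 'x measure \<Rightarrow> 'x measure \<Rightarrow> nat \<Rightarrow> real" where
  "filter_err N P \<pi>0 \<pi>s t =
     (SUP \<gamma>\<in>policies N P. expect N P \<pi>0 \<gamma> (t + N) (\<lambda>ys us.
        case zhat N P \<pi>0 ys us t of (\<pi>, wy, wu) \<Rightarrow>
          tv (SX P) (posterior N P (\<pi>, wy, wu)) (posterior N P (\<pi>s, wy, wu))))"

end

theory Submission
  imports Defs
begin

text \<open>
  Comparing the two Bellman equations at a window state \<open>z\<close> gives, for some action \<open>u\<close>,
  \<open>e z \<le> C * TV z + \<beta> * (\<Sum>y. P(y | z, u) * e (z'(z, u, y)))\<close>, where \<open>e\<close> is the difference of the value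
  functions, \<open>TV z\<close> the distance of the two posteriors and \<open>C = \<parallel>c\<parallel> / (1 - \<beta>)\<close>: changing the posterior
  costs \<open>\<parallel>c\<parallel> * TV z\<close> in the stage cost and \<open>\<beta> * C * TV z\<close> in the expected continuation, because \<open>C\<close>
  bounds the approximate value function, and \<open>\<parallel>c\<parallel> + \<beta> * C = C\<close>. Following these actions after time \<open>N\<close>
  is an admissible policy; iterating the inequality along it bounds the initial error by
  \<open>C * (\<Sum>t<T. \<beta> ^ t * L t) + \<beta> ^ T * sup e\<close> for every \<open>T\<close>.

  Since observations and actions are finite and policies deterministic, every expectation involved
  is a finite sum over observation lists, weighted by the probabilities that the filter assigns.
\<close>

section \<open>Bayes updates and predictions\<close>

locale pomdp_model =
  fixes P :: "('x::topological_space, 'y::finite, 'u::finite) pomdp"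
  assumes is_pomdp: "is_pomdp P"
begin

section \<open>Measurability, bounds and normalisation of the model data\<close>

abbreviation \<beta> :: real where "\<beta> \<equiv> disc P"

lemma disc_pos: "0 < \<beta>" and disc_less_1: "\<beta> < 1"
  using is_pomdp by (auto simp: is_pomdp_def)

lemma fallback_in_probs: "fallback P \<in> probs P"
  using is_pomdp by (auto simp: is_pomdp_def)

lemma probs_iff: "\<mu> \<in> probs P \<longleftrightarrow> sets \<mu> = sets (SX P) \<and> prob_space \<mu>"
  by (auto simp: probs_def space_prob_algebra)

lemma space_SX: "space (SX P) = St P"
  by (simp add: SX_def space_restrict_space)

lemma probs_space: "\<mu> \<in> probs P \<Longrightarrow> space \<mu> = St P"
  using sets_eq_imp_space_eq[of \<mu> "SX P"] by (simp add: probs_iff space_SX)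

lemma probs_measurable_iff: "\<mu> \<in> probs P \<Longrightarrow> f \<in> measurable \<mu> M \<longleftrightarrow> f \<in> measurable (SX P) M"
  using measurable_cong_sets[of \<mu> "SX P" M M] by (simp add: probs_iff)

lemma Tr_joint_measurable [measurable]:
  "(\<lambda>(x, u). Tr P x u) \<in> SX P \<Otimes>\<^sub>M count_space UNIV \<rightarrow>\<^sub>M prob_algebra (SX P)"
  using is_pomdp by (auto simp: is_pomdp_def)

lemma Tr_measurable [measurable]: "(\<lambda>x. Tr P x u) \<in> SX P \<rightarrow>\<^sub>M prob_algebra (SX P)"
  using measurable_compose[of "\<lambda>x. (x, u)", OF _ Tr_joint_measurable] by simp

lemma Ob_measurable [measurable]: "Ob P \<in> SX P \<rightarrow>\<^sub>M prob_algebra (count_space UNIV)"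
  using is_pomdp by (auto simp: is_pomdp_def)

lemma cost_measurable [measurable]: "(\<lambda>x. cost P x u) \<in> borel_measurable (SX P)"
proof -
  have "(\<lambda>(x, u). cost P x u) \<in> borel_measurable (SX P \<Otimes>\<^sub>M count_space UNIV)"
    using is_pomdp by (auto simp: is_pomdp_def)
  from measurable_compose[of "\<lambda>x. (x, u)", OF _ this] show ?thesis by simp
qed

lemma obs_lik_measurable [measurable]: "obs_lik P y \<in> borel_measurable (SX P)"
  unfolding obs_lik_def[abs_def] by measurable

lemma Tr_in_probs: "x \<in> St P \<Longrightarrow> Tr P x u \<in> probs P"
  using measurable_space[OF Tr_measurable[of u], of x] by (simp add: probs_def space_SX)

lemma Ob_prob:
  assumes "x \<in> St P"
  shows "sets (Ob P x) = UNIV" "prob_space (Ob P x)"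
  using measurable_space[OF Ob_measurable, of x] assms by (auto simp: space_prob_algebra space_SX)

lemma obs_lik_nonneg: "0 \<le> obs_lik P y x"
  by (simp add: obs_lik_def)

lemma obs_lik_le_1: "x \<in> St P \<Longrightarrow> obs_lik P y x \<le> 1"
  unfolding obs_lik_def using Ob_prob(2) prob_space.prob_le_1 by blast

lemma nn_integral_Ob:
  assumes "x \<in> St P"
  shows "(\<integral>\<^sup>+y. g y \<partial>Ob P x) = (\<Sum>y\<in>UNIV. ennreal (obs_lik P y x) * g y)"
proof -
  interpret prob_space "Ob P x" using Ob_prob(2)[OF assms] .
  have "(\<integral>\<^sup>+y. g y * indicator UNIV y \<partial>Ob P x) = (\<Sum>y\<in>UNIV. g y * emeasure (Ob P x) {y})"
    by (rule nn_integral_indicator_finite) (auto simp: Ob_prob(1)[OF assms])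
  then show ?thesis
    by (simp add: obs_lik_def emeasure_eq_measure mult.commute)
qed

lemma sum_obs_lik:
  assumes "x \<in> St P"
  shows "(\<Sum>y\<in>UNIV. obs_lik P y x) = 1"
proof -
  interpret prob_space "Ob P x" using Ob_prob(2)[OF assms] .
  have "ennreal (\<Sum>y\<in>UNIV. obs_lik P y x) = 1"
    using nn_integral_Ob[OF assms, of "\<lambda>_. 1"] emeasure_space_1
    by (simp add: sum_ennreal obs_lik_nonneg)
  then show ?thesis by (simp flip: ennreal_1 add: sum_nonneg obs_lik_nonneg)
qed

lemma probs_integrable:
  fixes f :: "'x \<Rightarrow> real"
  assumes "\<mu> \<in> probs P" "f \<in> borel_measurable (SX P)" "\<And>x. x \<in> St P \<Longrightarrow> \<bar>f x\<bar> \<le> K"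
  shows "integrable \<mu> f"
proof -
  interpret prob_space \<mu> using assms(1) by (simp add: probs_iff)
  show ?thesis
    by (rule integrable_const_bound[of _ K])
      (use assms in \<open>auto simp: probs_measurable_iff probs_space\<close>)
qed

lemma probs_integral_bound:
  fixes f :: "'x \<Rightarrow> real"
  assumes "\<mu> \<in> probs P" "f \<in> borel_measurable (SX P)" "\<And>x. x \<in> St P \<Longrightarrow> \<bar>f x\<bar> \<le> K"
  shows "\<bar>\<integral>x. f x \<partial>\<mu>\<bar> \<le> K"
proof -
  interpret prob_space \<mu> using assms(1) by (simp add: probs_iff)
  note [simp] = probs_integrable[OF assms]
  have "(\<integral>x. f x \<partial>\<mu>) \<le> K"
    by (rule integral_le_const) (use assms in \<open>auto simp: probs_space abs_le_iff\<close>)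
  moreover have "-K \<le> (\<integral>x. f x \<partial>\<mu>)"
    by (rule integral_ge_const) (use assms in \<open>auto simp: probs_space abs_le_iff minus_le_iff\<close>)
  ultimately show ?thesis by simp
qed

lemma obs_lik_abs: "x \<in> St P \<Longrightarrow> \<bar>obs_lik P y x\<bar> \<le> 1"
  using obs_lik_le_1[of x y] obs_lik_nonneg[of y x] by simp

lemma nn_integral_obs_lik:
  assumes "\<mu> \<in> probs P"
  shows "(\<integral>\<^sup>+x. ennreal (obs_lik P y x) \<partial>\<mu>) = ennreal (\<integral>x. obs_lik P y x \<partial>\<mu>)"
  by (rule nn_integral_eq_integral)
    (auto intro!: probs_integrable[OF assms, of _ 1] obs_lik_abs simp: obs_lik_nonneg)

section \<open>Bayes' rule and one-step prediction on probability measures\<close>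

lemma bayes_in_probs:
  assumes "\<mu> \<in> probs P"
  shows "bayes P \<mu> y \<in> probs P"
proof (cases "(\<integral>x. obs_lik P y x \<partial>\<mu>) = 0")
  case True
  then show ?thesis by (simp add: bayes_def fallback_in_probs)
next
  case False
  define d where "d = (\<integral>x. obs_lik P y x \<partial>\<mu>)"
  have "d \<ge> 0" unfolding d_def by (simp add: obs_lik_nonneg)
  with False have d: "d > 0" by (simp add: d_def)
  have [measurable]: "obs_lik P y \<in> borel_measurable \<mu>"
    by (simp add: probs_measurable_iff[OF assms])
  have "(\<integral>\<^sup>+x. ennreal (obs_lik P y x / d) \<partial>\<mu>) = (\<integral>\<^sup>+x. ennreal (obs_lik P y x) / ennreal d \<partial>\<mu>)"
    using d by (simp add: divide_ennreal obs_lik_nonneg)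
  also have "\<dots> = (\<integral>\<^sup>+x. ennreal (obs_lik P y x) \<partial>\<mu>) / ennreal d"
    by (rule nn_integral_divide) simp
  also have "\<dots> = 1"
    unfolding nn_integral_obs_lik[OF assms] d_def[symmetric] using d by (simp add: divide_ennreal)
  finally have "emeasure (density \<mu> (\<lambda>x. ennreal (obs_lik P y x / d))) (space \<mu>) = 1"
    by (subst emeasure_density) (auto cong: nn_integral_cong_simp)
  then have "prob_space (density \<mu> (\<lambda>x. ennreal (obs_lik P y x / d)))"
    by (intro prob_spaceI) simp
  with False assms show ?thesis
    by (simp add: bayes_def Let_def probs_iff flip: d_def)
qed

text \<open>Bayes' rule with the denominator multiplied out. In this form it covers observations of
  probability zero as well, so later sums over all observations need no case distinction.\<close>

lemma nn_integral_bayes: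
  assumes "\<mu> \<in> probs P" and g: "g \<in> borel_measurable (SX P)"
  shows "(\<integral>\<^sup>+x. ennreal (obs_lik P y x) * g x \<partial>\<mu>)
    = ennreal (\<integral>x. obs_lik P y x \<partial>\<mu>) * (\<integral>\<^sup>+x. g x \<partial>bayes P \<mu> y)"
proof -
  define d where "d = (\<integral>x. obs_lik P y x \<partial>\<mu>)"
  have "d \<ge> 0" unfolding d_def by (simp add: obs_lik_nonneg)
  have [measurable]: "obs_lik P y \<in> borel_measurable \<mu>" "g \<in> borel_measurable \<mu>"
    using g by (simp_all add: probs_measurable_iff[OF assms(1)])
  show ?thesis
  proof (cases "d = 0")
    \<comment> \<open>A likelihood with integral 0 vanishes almost everywhere, so the left side is
      0; the right side is 0 because of its first factor.\<close>
    case True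
    then have "(\<integral>\<^sup>+x. ennreal (obs_lik P y x) \<partial>\<mu>) = 0"
      by (simp add: nn_integral_obs_lik[OF assms(1)] d_def)
    then have "AE x in \<mu>. ennreal (obs_lik P y x) = 0"
      by (subst (asm) nn_integral_0_iff_AE) auto
    then have "AE x in \<mu>. ennreal (obs_lik P y x) * g x = 0" by auto
    then have "(\<integral>\<^sup>+x. ennreal (obs_lik P y x) * g x \<partial>\<mu>) = 0"
      by (subst nn_integral_0_iff_AE) auto
    with True show ?thesis by (simp add: d_def)
  next
    case False
    with \<open>d \<ge> 0\<close> have d: "d > 0" by simp
    have "(\<integral>\<^sup>+x. g x \<partial>bayes P \<mu> y) = (\<integral>\<^sup>+x. ennreal (obs_lik P y x / d) * g x \<partial>\<mu>)"
      using False by (simp add: bayes_def d_def[symmetric] nn_integral_density)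
    also have "ennreal d * \<dots> = (\<integral>\<^sup>+x. ennreal d * (ennreal (obs_lik P y x / d) * g x) \<partial>\<mu>)"
      by (rule nn_integral_cmult[symmetric]) simp
    also have "\<dots> = (\<integral>\<^sup>+x. ennreal (obs_lik P y x) * g x \<partial>\<mu>)"
      using d by (simp add: mult.assoc[symmetric] ennreal_mult'[symmetric])
    finally show ?thesis by (simp add: d_def)
  qed
qed

lemma bind_Tr_in_probs:
  assumes "\<mu> \<in> probs P"
  shows "\<mu> \<bind> (\<lambda>x. Tr P x u) \<in> probs P"
  using prob_space_bind'[of \<mu> "SX P" "\<lambda>x. Tr P x u" "SX P"] sets_bind'[of \<mu> "SX P" "\<lambda>x. Tr P x u" "SX P"] assms
  by (simp add: probs_iff space_prob_algebra)

lemma nn_integral_bind_Tr: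
  assumes "\<mu> \<in> probs P" "g \<in> borel_measurable (SX P)"
  shows "(\<integral>\<^sup>+x. g x \<partial>(\<mu> \<bind> (\<lambda>x. Tr P x u))) = (\<integral>\<^sup>+x. \<integral>\<^sup>+x'. g x' \<partial>Tr P x u \<partial>\<mu>)"
  by (rule nn_integral_bind[where B = "SX P"])
    (use assms in \<open>auto simp: probs_measurable_iff intro: measurable_prob_algebraD\<close>)

lemma predict_in_probs: "\<mu> \<in> probs P \<Longrightarrow> predict P \<mu> y u \<in> probs P"
  by (simp add: predict_def bayes_in_probs bind_Tr_in_probs)

lemma predictor_in_probs: "\<mu> \<in> probs P \<Longrightarrow> predictor P \<mu> y u t \<in> probs P"
  by (induction t) (simp_all add: predict_in_probs)

lemma filt_in_probs: "\<mu> \<in> probs P \<Longrightarrow> filt P \<mu> y u t \<in> probs P"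
  by (induction t) (simp_all add: bayes_in_probs bind_Tr_in_probs)

lemma integral_obs_lik_Tr_measurable [measurable]:
  "(\<lambda>x. \<integral>x'. obs_lik P y x' \<partial>Tr P x u) \<in> borel_measurable (SX P)"
  by (rule measurable_compose[OF measurable_prob_algebraD[OF Tr_measurable]
        integral_measurable_subprob_algebra]) simp

lemma integral_obs_lik_nonneg: "0 \<le> (\<integral>x. obs_lik P y x \<partial>\<mu>)"
  by (simp add: obs_lik_nonneg)

lemma sum_integral_obs_lik:
  assumes "\<mu> \<in> probs P"
  shows "(\<Sum>y\<in>UNIV. \<integral>x. obs_lik P y x \<partial>\<mu>) = 1"
proof -
  interpret prob_space \<mu> using assms by (simp add: probs_iff)
  have "(\<Sum>y\<in>UNIV. \<integral>x. obs_lik P y x \<partial>\<mu>) = (\<integral>x. (\<Sum>y\<in>UNIV. obs_lik P y x) \<partial>\<mu>)"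
    by (rule Bochner_Integration.integral_sum[symmetric])
      (rule probs_integrable[OF assms obs_lik_measurable obs_lik_abs])
  also have "\<dots> = (\<integral>x. 1 \<partial>\<mu>)"
    by (rule Bochner_Integration.integral_cong) (simp_all add: sum_obs_lik probs_space[OF assms])
  finally show ?thesis by (simp add: prob_space)
qed

text \<open>Integrating against a bind is iterated integration. The computation runs through
  nonnegative integrals, and boundedness of the likelihood by 1 brings it back to real integrals.
  The right side is the denominator in the next Bayes update.\<close>

lemma obs_pred_eq:
  assumes "\<mu> \<in> probs P"
  shows "obs_pred P \<mu> y u k y' = (\<integral>x. obs_lik P y' x \<partial>(filt P \<mu> y u k \<bind> (\<lambda>x. Tr P x (u k))))"
proof -
  let ?f = "filt P \<mu> y u k" and ?q = "\<lambda>x. \<integral>x'. obs_lik P y' x' \<partial>Tr P x (u k)"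
  have f: "?f \<in> probs P" by (rule filt_in_probs[OF assms])
  have q: "\<bar>?q x\<bar> \<le> 1" if "x \<in> St P" for x
    using that by (auto intro!: probs_integral_bound Tr_in_probs obs_lik_abs)
  have "ennreal (\<integral>x. obs_lik P y' x \<partial>(?f \<bind> (\<lambda>x. Tr P x (u k))))
    = (\<integral>\<^sup>+x. \<integral>\<^sup>+x'. ennreal (obs_lik P y' x') \<partial>Tr P x (u k) \<partial>?f)"
    unfolding nn_integral_obs_lik[OF bind_Tr_in_probs[OF f], symmetric]
    by (rule nn_integral_bind_Tr[OF f]) simp
  also have "\<dots> = (\<integral>\<^sup>+x. ennreal (?q x) \<partial>?f)"
    by (rule nn_integral_cong) (simp add: probs_space[OF f] nn_integral_obs_lik Tr_in_probs)
  also have "\<dots> = ennreal (\<integral>x. ?q x \<partial>?f)"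
    by (rule nn_integral_eq_integral)
      (auto intro!: probs_integrable[OF f, of _ 1] q simp: integral_obs_lik_nonneg)
  finally show ?thesis
    unfolding obs_pred_def by (simp add: integral_obs_lik_nonneg)
qed

lemma obs_pred_nonneg: "0 \<le> obs_pred P \<mu> y u k y'"
  unfolding obs_pred_def by (intro integral_nonneg_AE AE_I2 integral_obs_lik_nonneg)

lemma sum_obs_pred: "\<mu> \<in> probs P \<Longrightarrow> (\<Sum>y'\<in>UNIV. obs_pred P \<mu> y u k y') = 1"
  by (simp add: obs_pred_eq sum_integral_obs_lik bind_Tr_in_probs filt_in_probs)

end

section \<open>Disintegration of the law of the history\<close>

text \<open>A deterministic rule makes the action list a function of the observation list, so
  histories can be indexed by observations alone. The action at time \<open>n\<close> is chosen
  after observation \<open>n\<close>, hence \<open>take (Suc n)\<close>.\<close>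

primrec play :: "('y list \<Rightarrow> 'u list \<Rightarrow> 'u) \<Rightarrow> nat \<Rightarrow> 'y list \<Rightarrow> 'u list" where
  "play F 0 ys = []"
| "play F (Suc n) ys = play F n ys @ [F (take (Suc n) ys) (play F n ys)]"

lemma length_play [simp]: "length (play F n ys) = n"
  by (induction n) simp_all

lemma play_append [simp]: "n \<le> length ys \<Longrightarrow> play F n (ys @ zs) = play F n ys"
  by (induction n) simp_all

text \<open>Agreement of the two rules is required only along the history that \<open>F\<close>
  itself generates. This suits a policy that coincides with a given rule on reachable histories
  only.\<close>

lemma play_cong:
  assumes "\<And>m. m < n \<Longrightarrow> F (take (Suc m) ys) (play F m ys) = G (take (Suc m) ys) (play F m ys)"
  shows "play F n ys = play G n ys"
  using assms
proof (induction n)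
  case (Suc n)
  then have "play F n ys = play G n ys" by simp
  with Suc.prems[of n] show ?case by simp
qed simp

lemma sum_lists_Suc:
  fixes f :: "'y::finite list \<Rightarrow> 'b::comm_monoid_add"
  shows "(\<Sum>ys | length ys = Suc n. f ys) = (\<Sum>ys | length ys = n. \<Sum>y\<in>UNIV. f (ys @ [y]))"
proof -
  have "(\<Sum>ys | length ys = Suc n. f ys) = (\<Sum>(ys, y)\<in>{ys. length ys = n} \<times> UNIV. f (ys @ [y]))"
    by (rule sum.reindex_bij_witness[of _ "\<lambda>(ys, y). ys @ [y]" "\<lambda>ys. (butlast ys, last ys)"])
      (auto simp: length_Suc_conv_rev)
  then show ?thesis
    using finite_lists_length_eq[of "UNIV :: 'y set" n] by (simp add: sum.cartesian_product)
qed

section \<open>Locality and time shifts of the filter\<close>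

lemma filt_cong:
  assumes "\<And>i. i \<le> n \<Longrightarrow> y i = y' i" "\<And>i. i < n \<Longrightarrow> u i = u' i"
  shows "filt P \<mu> y u n = filt P \<mu> y' u' n"
  using assms by (induction n) auto

lemma predictor_cong:
  assumes "\<And>i. i < n \<Longrightarrow> y i = y' i" "\<And>i. i < n \<Longrightarrow> u i = u' i"
  shows "predictor P \<mu> y u n = predictor P \<mu> y' u' n"
  using assms by (induction n) auto

lemma obs_pred_cong:
  assumes "\<And>i. i \<le> n \<Longrightarrow> y i = y' i" "\<And>i. i \<le> n \<Longrightarrow> u i = u' i"
  shows "obs_pred P \<mu> y u n v = obs_pred P \<mu> y' u' n v"
  using filt_cong[of n y y' u u' P \<mu>] assms by (auto simp: obs_pred_def)

lemma filt_eq_bayes_predictor: "filt P \<mu> y u k = bayes P (predictor P \<mu> y u k) (y k)"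
  by (induction k) (simp_all add: predict_def)

text \<open>The predictor carries all information about the past: a Bayes update of it at time
  \<open>t\<close> is already the filter at time \<open>t\<close>, and from there on both recursions
  are the same. Hence a posterior computed from a window equals the one computed from the whole
  history.\<close>

lemma filt_shift:
  "filt P (predictor P \<mu> y u t) (\<lambda>i. y (t + i)) (\<lambda>i. u (t + i)) k = filt P \<mu> y u (t + k)"
  by (induction k) (simp_all add: filt_eq_bayes_predictor[of P \<mu> y u t])

lemma obs_pred_shift:
  "obs_pred P (predictor P \<mu> y u t) (\<lambda>i. y (t + i)) (\<lambda>i. u (t + i)) k v = obs_pred P \<mu> y u (t + k) v"
  by (simp add: obs_pred_def filt_shift)

lemma next_obs_zhat:
  assumes "length ys = Suc (t + N)" "length us = t + N"
  shows "next_obs N P (zhat N P \<mu> ys us t) u v = obs_pred P \<mu> (nth ys) (nth (us @ [u])) (t + N) v"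
proof -
  have "predictor P \<mu> (nth ys) (nth us) t = predictor P \<mu> (nth ys) (nth (us @ [u])) t"
    using assms by (intro predictor_cong) (auto simp: nth_append)
  moreover have "obs_pred P \<pi> (nth (take (Suc N) (drop t ys))) (nth (take N (drop t us) @ [u])) N v
      = obs_pred P \<pi> (\<lambda>i. ys ! (t + i)) (\<lambda>i. (us @ [u]) ! (t + i)) N v" for \<pi>
    using assms by (intro obs_pred_cong) (auto simp: nth_append)
  ultimately show ?thesis
    by (simp add: next_obs_def zhat_def obs_pred_shift)
qed

text \<open>Ties the actual process to the transition that occurs in
  \<open>is_value_function\<close>: the entries leaving the window are exactly those that the
  predictor at \<open>Suc t\<close> absorbs.\<close>

lemma zhat_snoc:
  assumes "length ys = Suc (t + N)" "length us = t + N"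
  shows "zhat N P \<mu> (ys @ [v]) (us @ [u]) (Suc t) =
    (case zhat N P \<mu> ys us t of (\<pi>, wy, wu) \<Rightarrow>
      (predict P \<pi> (hd wy) (hd (wu @ [u])), tl (wy @ [v]), tl (wu @ [u])))"
proof -
  have "predictor P \<mu> (nth (ys @ [v])) (nth (us @ [u])) t = predictor P \<mu> (nth ys) (nth us) t"
    using assms by (intro predictor_cong) (auto simp: nth_append)
  moreover have "hd (take (Suc N) (drop t ys)) = ys ! t"
    using assms by (simp add: hd_conv_nth)
  \<comment> \<open>For \<open>N = 0\<close> the list \<open>drop t us\<close> is empty and both
    sides are the appended action \<open>u\<close>.\<close>
  moreover have "hd (drop t us @ [u]) = (us @ [u]) ! t"
    using assms by (simp add: hd_append hd_drop_conv_nth nth_append)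
  moreover have tl: "tl (drop t zs) = drop (Suc t) zs" for zs :: "'z list"
    by (simp add: drop_Suc tl_drop)
  moreover have "tl (drop t ys @ [v]) = drop (Suc t) (ys @ [v])"
    using tl[of "ys @ [v]"] assms by simp
  moreover have "tl (drop t us @ [u]) = drop (Suc t) (us @ [u])"
    using tl[of "us @ [u]"] assms by simp
  ultimately show ?thesis
    using assms by (simp add: zhat_def nth_append del: drop_append)
qed

section \<open>The law of the history as a mixture of filters\<close>

context pomdp_model
begin

text \<open>The chain rule for the probability of the observations \<open>y 0, ..., y n\<close> when
  the actions are prescribed to be \<open>u\<close>.\<close>

primrec hist_prob :: "'x measure \<Rightarrow> (nat \<Rightarrow> 'y) \<Rightarrow> (nat \<Rightarrow> 'u) \<Rightarrow> nat \<Rightarrow> real" where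
  "hist_prob \<mu> y u 0 = (\<integral>x. obs_lik P (y 0) x \<partial>\<mu>)"
| "hist_prob \<mu> y u (Suc n) = hist_prob \<mu> y u n * obs_pred P \<mu> y u n (y (Suc n))"

lemma hist_prob_nonneg: "0 \<le> hist_prob \<mu> y u n"
  by (induction n) (simp_all add: obs_lik_nonneg obs_pred_nonneg)

lemma hist_prob_cong:
  assumes "\<And>i. i \<le> n \<Longrightarrow> y i = y' i" "\<And>i. i < n \<Longrightarrow> u i = u' i"
  shows "hist_prob \<mu> y u n = hist_prob \<mu> y' u' n"
  using assms
proof (induction n)
  case (Suc n)
  have "obs_pred P \<mu> y u n v = obs_pred P \<mu> y' u' n v" for v
    using Suc.prems by (intro obs_pred_cong) auto
  with Suc show ?case by simp
qed simp

text \<open>Lists over finite types are countable, so the two discrete factors merge into one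
  discrete space, on which every function is measurable.\<close>

lemma Hist_eq: "Hist P = SX P \<Otimes>\<^sub>M count_space UNIV"
  unfolding Hist_def by (subst pair_measure_countable) auto

text \<open>The rule \<open>F\<close> can be arbitrary because it reads only the discrete part of
  the history; measurability in the state comes from \<open>Tr\<close> and
  \<open>Ob\<close>.\<close>

lemma hist_kernel_measurable:
  "(\<lambda>(x, ys, us). Tr P x (F ys us) \<bind> (\<lambda>x'. Ob P x' \<bind>
     (\<lambda>y'. return (Hist P) (x', ys @ [y'], us @ [F ys us])))) \<in> Hist P \<rightarrow>\<^sub>M prob_algebra (Hist P)"
proof -
  let ?a = "\<lambda>h. F (fst h) (snd h)"
  have a: "(\<lambda>w. (fst w, ?a (snd w))) \<in> Hist P \<rightarrow>\<^sub>M SX P \<Otimes>\<^sub>M count_space UNIV"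
    unfolding Hist_eq by measurable
  have Tr: "(\<lambda>w. Tr P (fst w) (?a (snd w))) \<in> Hist P \<rightarrow>\<^sub>M prob_algebra (SX P)"
    using measurable_compose[OF a Tr_joint_measurable] by simp
  \<comment> \<open>The old lists and the new observation together still range over a countable
    type, so extending the lists is measurable as a map between discrete spaces.\<close>
  have pair: "(\<lambda>z. (snd (fst (fst z)), snd z)) \<in> (Hist P \<Otimes>\<^sub>M SX P) \<Otimes>\<^sub>M count_space UNIV
      \<rightarrow>\<^sub>M count_space (UNIV :: (('y list \<times> 'u list) \<times> 'y) set)"
    unfolding Hist_eq UNIV_Times_UNIV[symmetric]
    by (subst pair_measure_countable[symmetric]) (auto simp del: UNIV_Times_UNIV)
  have h: "(\<lambda>z. case (snd (fst (fst z)), snd z) of (h, y') \<Rightarrow> (fst h @ [y'], snd h @ [?a h]))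
      \<in> (Hist P \<Otimes>\<^sub>M SX P) \<Otimes>\<^sub>M count_space UNIV \<rightarrow>\<^sub>M count_space UNIV"
    by (rule measurable_compose[OF pair]) simp
  have "(\<lambda>z. (snd (fst z), fst (snd (fst (fst z))) @ [snd z], snd (snd (fst (fst z))) @ [?a (snd (fst (fst z)))]))
      \<in> (Hist P \<Otimes>\<^sub>M SX P) \<Otimes>\<^sub>M count_space UNIV \<rightarrow>\<^sub>M Hist P"
    unfolding Hist_eq by (rule measurable_Pair) (use h in \<open>simp_all add: Hist_eq\<close>)
  from measurable_compose[OF this measurable_return_prob_space]
  have "(\<lambda>w. Tr P (fst w) (?a (snd w)) \<bind> (\<lambda>x'. Ob P x' \<bind>
     (\<lambda>y'. return (Hist P) (x', fst (snd w) @ [y'], snd (snd w) @ [?a (snd w)])))) \<in> Hist P \<rightarrow>\<^sub>M prob_algebra (Hist P)"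
    by (intro measurable_bind_prob_space2[OF Tr])
      (auto simp: split_beta' intro!: measurable_bind_prob_space2[where N = "count_space UNIV"]
         measurable_compose[OF measurable_snd Ob_measurable])
  then show ?thesis by (simp add: split_beta')
qed

lemma nn_integral_obs_kernel:
  assumes "\<mu> \<in> probs P" and g: "g \<in> borel_measurable (Hist P)"
  shows "(\<integral>\<^sup>+w. g w \<partial>(\<mu> \<bind> (\<lambda>x. Ob P x \<bind> (\<lambda>y. return (Hist P) (x, ys @ [y], us)))))
    = (\<integral>\<^sup>+x. (\<Sum>y\<in>UNIV. ennreal (obs_lik P y x) * g (x, ys @ [y], us)) \<partial>\<mu>)"
proof -
  have h: "(\<lambda>z. (fst z, ys @ [snd z], us)) \<in> SX P \<Otimes>\<^sub>M count_space UNIV \<rightarrow>\<^sub>M Hist P"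
    unfolding Hist_eq by (rule measurable_Pair) (auto intro: measurable_compose[OF measurable_snd])
  have k: "(\<lambda>x. Ob P x \<bind> (\<lambda>y. return (Hist P) (x, ys @ [y], us))) \<in> SX P \<rightarrow>\<^sub>M prob_algebra (Hist P)"
    using measurable_compose[OF h measurable_return_prob_space]
    by (intro measurable_bind_prob_space2[OF Ob_measurable]) (simp add: split_beta')
  have "(\<integral>\<^sup>+w. g w \<partial>(\<mu> \<bind> (\<lambda>x. Ob P x \<bind> (\<lambda>y. return (Hist P) (x, ys @ [y], us)))))
    = (\<integral>\<^sup>+x. \<integral>\<^sup>+w. g w \<partial>(Ob P x \<bind> (\<lambda>y. return (Hist P) (x, ys @ [y], us))) \<partial>\<mu>)"
    by (rule nn_integral_bind[OF g])
      (use k assms(1) in \<open>auto simp: probs_measurable_iff intro: measurable_prob_algebraD\<close>)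
  also have "\<dots> = (\<integral>\<^sup>+x. (\<Sum>y\<in>UNIV. ennreal (obs_lik P y x) * g (x, ys @ [y], us)) \<partial>\<mu>)"
  proof (rule nn_integral_cong)
    fix x assume "x \<in> space \<mu>"
    then have x: "x \<in> St P" by (simp add: probs_space[OF assms(1)])
    then have sp: "(x, ys @ [y], us) \<in> space (Hist P)" for y
      by (simp add: Hist_eq space_pair_measure space_SX)
    have "(\<integral>\<^sup>+w. g w \<partial>(Ob P x \<bind> (\<lambda>y. return (Hist P) (x, ys @ [y], us))))
      = (\<integral>\<^sup>+y. \<integral>\<^sup>+w. g w \<partial>return (Hist P) (x, ys @ [y], us) \<partial>Ob P x)"
    proof (rule nn_integral_bind[OF g])
      show "(\<lambda>y. return (Hist P) (x, ys @ [y], us)) \<in> Ob P x \<rightarrow>\<^sub>M subprob_algebra (Hist P)"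
        using sp by (subst measurable_cong_sets[of _ "count_space UNIV"])
          (auto simp: Ob_prob(1)[OF x] space_subprob_algebra intro!: subprob_space_return)
    qed
    also have "\<dots> = (\<Sum>y\<in>UNIV. ennreal (obs_lik P y x) * g (x, ys @ [y], us))"
      by (simp add: nn_integral_return[OF sp g] nn_integral_Ob[OF x])
    finally show "(\<integral>\<^sup>+w. g w \<partial>(Ob P x \<bind> (\<lambda>y. return (Hist P) (x, ys @ [y], us))))
      = (\<Sum>y\<in>UNIV. ennreal (obs_lik P y x) * g (x, ys @ [y], us))" .
  qed
  finally show ?thesis .
qed

lemma Hist_slice_measurable:
  "g \<in> borel_measurable (Hist P) \<Longrightarrow> (\<lambda>x. g (x, h)) \<in> borel_measurable (SX P)"
  unfolding Hist_eq by (rule measurable_compose[of "\<lambda>x. (x, h)"]) simp_all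

lemma nn_integral_obs_kernel_bayes:
  assumes "\<mu> \<in> probs P" and g: "g \<in> borel_measurable (Hist P)"
  shows "(\<integral>\<^sup>+w. g w \<partial>(\<mu> \<bind> (\<lambda>x. Ob P x \<bind> (\<lambda>y. return (Hist P) (x, ys @ [y], us)))))
    = (\<Sum>y\<in>UNIV. ennreal (\<integral>x. obs_lik P y x \<partial>\<mu>) * (\<integral>\<^sup>+x. g (x, ys @ [y], us) \<partial>bayes P \<mu> y))"
proof -
  have [measurable]: "(\<lambda>x. g (x, h)) \<in> borel_measurable \<mu>" "obs_lik P y \<in> borel_measurable \<mu>" for h y
    using Hist_slice_measurable[OF g] by (simp_all add: probs_measurable_iff[OF assms(1)])
  show ?thesis
    unfolding nn_integral_obs_kernel[OF assms]
    by (simp add: nn_integral_sum nn_integral_bayes[OF assms(1) Hist_slice_measurable[OF g]])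
qed

text \<open>Induction over time: the filter is pushed through \<open>Tr\<close>, and Bayes' rule
  splits the result by the new observation into its predictive probability, which extends
  \<open>hist_prob\<close>, and the next filter. Both claims share one induction because integrating
  over the bind at time \<open>Suc n\<close> uses that the law at time \<open>n\<close> lives on
  \<open>Hist P\<close>.\<close>

lemma law_disintegration:
  fixes N \<mu> \<gamma>
  defines "F \<equiv> act N P \<mu> \<gamma>"
  assumes \<mu>: "\<mu> \<in> probs P"
  shows law_prob: "law N P \<mu> \<gamma> n \<in> space (prob_algebra (Hist P))"
    and nn_integral_law: "g \<in> borel_measurable (Hist P) \<Longrightarrow> (\<integral>\<^sup>+w. g w \<partial>law N P \<mu> \<gamma> n) =
      (\<Sum>ys | length ys = Suc n. ennreal (hist_prob \<mu> (nth ys) (nth (play F n ys)) n)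
        * (\<integral>\<^sup>+x. g (x, ys, play F n ys) \<partial>filt P \<mu> (nth ys) (nth (play F n ys)) n))"
proof (induction n arbitrary: g)
  case 0
  {
    case 1
    have h: "(\<lambda>z. (fst z, [snd z], [])) \<in> SX P \<Otimes>\<^sub>M count_space UNIV \<rightarrow>\<^sub>M Hist P"
      unfolding Hist_eq by (rule measurable_Pair) (auto intro: measurable_compose[OF measurable_snd])
    have k: "(\<lambda>x. Ob P x \<bind> (\<lambda>y. return (Hist P) (x, [y], []))) \<in> SX P \<rightarrow>\<^sub>M prob_algebra (Hist P)"
      using measurable_compose[OF h measurable_return_prob_space]
      by (intro measurable_bind_prob_space2[OF Ob_measurable]) (simp add: split_beta')
    show ?case
      using prob_space_bind'[OF _ k] sets_bind'[OF _ k] \<mu>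
      by (simp add: space_prob_algebra probs_def)
  next
    case (2 g)
    show ?case
      using nn_integral_obs_kernel_bayes[OF \<mu> 2, of "[]" "[]"] by (simp add: sum_lists_Suc)
  }
next
  case (Suc n)
  let ?K = "\<lambda>(x, ys, us). Tr P x (F ys us) \<bind> (\<lambda>x'. Ob P x' \<bind>
     (\<lambda>y'. return (Hist P) (x', ys @ [y'], us @ [F ys us])))"
  have law_Suc: "law N P \<mu> \<gamma> (Suc n) = law N P \<mu> \<gamma> n \<bind> ?K"
    by (simp add: F_def)
  note K = hist_kernel_measurable[of F]
  {
    case 1
    show ?case
      using prob_space_bind'[OF Suc.IH(1) K] sets_bind'[OF Suc.IH(1) K]
      unfolding law_Suc by (simp add: space_prob_algebra)
  next
    case (2 g)
    have sets: "sets (law N P \<mu> \<gamma> n) = sets (Hist P)"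
      using Suc.IH(1) by (simp add: space_prob_algebra)
    have g': "(\<lambda>w. \<integral>\<^sup>+v. g v \<partial>?K w) \<in> borel_measurable (Hist P)"
      by (rule measurable_compose[OF measurable_prob_algebraD[OF K] nn_integral_measurable_subprob_algebra[OF 2]])
    let ?u = "play F n"
    have "(\<integral>\<^sup>+w. g w \<partial>law N P \<mu> \<gamma> (Suc n)) = (\<integral>\<^sup>+w. \<integral>\<^sup>+v. g v \<partial>?K w \<partial>law N P \<mu> \<gamma> n)"
      unfolding law_Suc by (rule nn_integral_bind[OF 2])
        (use measurable_prob_algebraD[OF K] measurable_cong_sets[OF sets refl] in blast)
    also have "\<dots> = (\<Sum>ys | length ys = Suc n. ennreal (hist_prob \<mu> (nth ys) (nth (?u ys)) n)
        * (\<integral>\<^sup>+x. \<integral>\<^sup>+v. g v \<partial>?K (x, ys, ?u ys) \<partial>filt P \<mu> (nth ys) (nth (?u ys)) n))"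
      by (rule Suc.IH(2)[OF g'])
    also have "\<dots> = (\<Sum>ys | length ys = Suc n. \<Sum>y\<in>UNIV.
        ennreal (hist_prob \<mu> (nth (ys @ [y])) (nth (play F (Suc n) (ys @ [y]))) (Suc n))
        * (\<integral>\<^sup>+x. g (x, ys @ [y], play F (Suc n) (ys @ [y]))
            \<partial>filt P \<mu> (nth (ys @ [y])) (nth (play F (Suc n) (ys @ [y]))) (Suc n)))"
    proof (rule sum.cong[OF refl])
      fix ys :: "'y list" assume "ys \<in> {ys. length ys = Suc n}"
      then have len: "length ys = Suc n" by simp
      let ?a = "F ys (?u ys)"
      let ?f = "filt P \<mu> (nth ys) (nth (?u ys)) n"
      let ?\<nu> = "?f \<bind> (\<lambda>x. Tr P x ?a)"
      have f: "?f \<in> probs P" and \<nu>: "?\<nu> \<in> probs P"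
        by (simp_all add: filt_in_probs[OF \<mu>] bind_Tr_in_probs)
      \<comment> \<open>Quantities up to time \<open>n\<close> do not see the appended entries; only
        the prediction of the new observation uses the appended action \<open>?a\<close>, which has
        index \<open>n\<close>.\<close>
      have filt1: "filt P \<mu> (nth (ys @ [y])) (nth (?u ys @ [?a])) n = ?f" for y
        using len by (intro filt_cong) (auto simp: nth_append)
      have hist1: "hist_prob \<mu> (nth (ys @ [y])) (nth (?u ys @ [?a])) n = hist_prob \<mu> (nth ys) (nth (?u ys)) n" for y
        using len by (intro hist_prob_cong) (auto simp: nth_append)
      have pred1: "obs_pred P \<mu> (nth (ys @ [y])) (nth (?u ys @ [?a])) n y = (\<integral>x. obs_lik P y x \<partial>?\<nu>)" for y
        by (simp add: obs_pred_eq[OF \<mu>] filt1 nth_append)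
      have "(\<integral>\<^sup>+x. \<integral>\<^sup>+v. g v \<partial>?K (x, ys, ?u ys) \<partial>?f)
        = (\<integral>\<^sup>+x. \<integral>\<^sup>+x'. (\<Sum>y\<in>UNIV. ennreal (obs_lik P y x') * g (x', ys @ [y], ?u ys @ [?a])) \<partial>Tr P x ?a \<partial>?f)"
        by (rule nn_integral_cong)
          (simp add: probs_space[OF f] nn_integral_obs_kernel[OF Tr_in_probs 2])
      also have "\<dots> = (\<integral>\<^sup>+x'. (\<Sum>y\<in>UNIV. ennreal (obs_lik P y x') * g (x', ys @ [y], ?u ys @ [?a])) \<partial>?\<nu>)"
        by (rule nn_integral_bind_Tr[OF f, symmetric])
          (use Hist_slice_measurable[OF 2] in measurable)
      also have "\<dots> = (\<integral>\<^sup>+w. g w \<partial>(?\<nu> \<bind> (\<lambda>x. Ob P x \<bind> (\<lambda>y. return (Hist P) (x, ys @ [y], ?u ys @ [?a])))))"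
        by (rule nn_integral_obs_kernel[OF \<nu> 2, symmetric])
      also have "\<dots> = (\<Sum>y\<in>UNIV. ennreal (\<integral>x. obs_lik P y x \<partial>?\<nu>)
          * (\<integral>\<^sup>+x. g (x, ys @ [y], ?u ys @ [?a]) \<partial>bayes P ?\<nu> y))"
        by (rule nn_integral_obs_kernel_bayes[OF \<nu> 2])
      finally have "(\<integral>\<^sup>+x. \<integral>\<^sup>+v. g v \<partial>?K (x, ys, ?u ys) \<partial>?f) = \<dots>" .
      then show "ennreal (hist_prob \<mu> (nth ys) (nth (?u ys)) n)
          * (\<integral>\<^sup>+x. \<integral>\<^sup>+v. g v \<partial>?K (x, ys, ?u ys) \<partial>?f) =
        (\<Sum>y\<in>UNIV.
        ennreal (hist_prob \<mu> (nth (ys @ [y])) (nth (play F (Suc n) (ys @ [y]))) (Suc n))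
        * (\<integral>\<^sup>+x. g (x, ys @ [y], play F (Suc n) (ys @ [y]))
            \<partial>filt P \<mu> (nth (ys @ [y])) (nth (play F (Suc n) (ys @ [y]))) (Suc n)))"
        using len
        by (simp add: filt1 hist1 pred1 sum_distrib_left ennreal_mult hist_prob_nonneg
            integral_obs_lik_nonneg mult.assoc nth_append_length[of ys, unfolded len]
            nth_append_length[of "?u ys", unfolded length_play])
    qed
    finally show ?case by (simp only: sum_lists_Suc)
  }
qed

text \<open>The expectation of a function of the history as a finite sum. It makes sense for every
  rule \<open>F\<close>, including one obtained from the axiom of choice that is not presented as a
  policy.\<close>

definition hist_sum :: "'x measure \<Rightarrow> ('y list \<Rightarrow> 'u list \<Rightarrow> 'u) \<Rightarrow> nat \<Rightarrow> ('y list \<Rightarrow> 'u list \<Rightarrow> real) \<Rightarrow> real" where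
  "hist_sum \<mu> F n f = (\<Sum>ys | length ys = Suc n.
     hist_prob \<mu> (nth ys) (nth (play F n ys)) n * f ys (play F n ys))"

text \<open>In the disintegration the integrand is constant in the state and each filter has mass
  one, so the inner integrals disappear. Nonnegativity of \<open>f\<close> allows the passage
  through the nonnegative integral, whose value is a finite sum of finite terms.\<close>

lemma expect_eq_hist_sum:
  assumes \<mu>: "\<mu> \<in> probs P" and f: "\<And>ys us. 0 \<le> f ys us"
  shows "expect N P \<mu> \<gamma> n f = hist_sum \<mu> (act N P \<mu> \<gamma>) n f"
proof -
  let ?F = "act N P \<mu> \<gamma>"
  let ?g = "\<lambda>w. f (fst (snd w)) (snd (snd w))"
  have g: "?g \<in> borel_measurable (Hist P)"
    unfolding Hist_eq by (rule measurable_compose[OF measurable_snd]) simp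
  have sets: "sets (law N P \<mu> \<gamma> n) = sets (Hist P)"
    using law_prob[OF \<mu>] by (simp add: space_prob_algebra)
  have "expect N P \<mu> \<gamma> n f = (\<integral>w. ?g w \<partial>law N P \<mu> \<gamma> n)"
    by (simp add: expect_def split_beta')
  also have "\<dots> = enn2real (\<integral>\<^sup>+w. ennreal (?g w) \<partial>law N P \<mu> \<gamma> n)"
    by (rule integral_eq_nn_integral) (use g f measurable_cong_sets[OF sets refl] in auto)
  also have "(\<integral>\<^sup>+w. ennreal (?g w) \<partial>law N P \<mu> \<gamma> n) = (\<Sum>ys | length ys = Suc n.
      ennreal (hist_prob \<mu> (nth ys) (nth (play ?F n ys)) n * f ys (play ?F n ys)))"
  proof (subst nn_integral_law[OF \<mu>], use g in simp, rule sum.cong[OF refl])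
    fix ys
    interpret prob_space "filt P \<mu> (nth ys) (nth (play ?F n ys)) n"
      using filt_in_probs[OF \<mu>] by (simp add: probs_iff)
    show "ennreal (hist_prob \<mu> (nth ys) (nth (play ?F n ys)) n) *
        (\<integral>\<^sup>+x. ennreal (f (fst (snd (x, ys, play ?F n ys))) (snd (snd (x, ys, play ?F n ys))))
          \<partial>filt P \<mu> (nth ys) (nth (play ?F n ys)) n)
      = ennreal (hist_prob \<mu> (nth ys) (nth (play ?F n ys)) n * f ys (play ?F n ys))"
      by (simp add: emeasure_space_1 ennreal_mult hist_prob_nonneg f)
  qed
  also have "enn2real \<dots> = hist_sum \<mu> ?F n f"
    unfolding hist_sum_def
    by (subst sum_ennreal) (auto simp: hist_prob_nonneg f intro!: enn2real_ennreal sum_nonneg)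
  finally show ?thesis .
qed

text \<open>Tower property: the last observation is averaged out given the earlier history, with
  \<open>obs_pred\<close> as its conditional law.\<close>

lemma hist_sum_Suc:
  "hist_sum \<mu> F (Suc n) f = hist_sum \<mu> F n (\<lambda>ys us. \<Sum>y\<in>UNIV.
     obs_pred P \<mu> (nth ys) (nth (us @ [F ys us])) n y * f (ys @ [y]) (us @ [F ys us]))"
  unfolding hist_sum_def sum_lists_Suc[of _ "Suc n"]
proof (rule sum.cong[OF refl])
  fix ys :: "'y list" assume "ys \<in> {ys. length ys = Suc n}"
  then have len: "length ys = Suc n" by simp
  let ?u = "play F n ys"
  let ?a = "F ys ?u"
  have hist1: "hist_prob \<mu> (nth (ys @ [y])) (nth (?u @ [?a])) n = hist_prob \<mu> (nth ys) (nth ?u) n" for y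
    using len by (intro hist_prob_cong) (auto simp: nth_append)
  have pred1: "obs_pred P \<mu> (nth (ys @ [y])) (nth (?u @ [?a])) n v = obs_pred P \<mu> (nth ys) (nth (?u @ [?a])) n v" for y v
    using len by (intro obs_pred_cong) (auto simp: nth_append)
  show "(\<Sum>y\<in>UNIV. hist_prob \<mu> (nth (ys @ [y])) (nth (play F (Suc n) (ys @ [y]))) (Suc n)
        * f (ys @ [y]) (play F (Suc n) (ys @ [y])))
    = hist_prob \<mu> (nth ys) (nth ?u) n * (\<Sum>y\<in>UNIV. obs_pred P \<mu> (nth ys) (nth (?u @ [?a])) n y
        * f (ys @ [y]) (?u @ [?a]))"
    using len by (simp add: hist1 pred1 sum_distrib_left mult.assoc nth_append_length[of ys, unfolded len])
qed

lemma hist_sum_const: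
  assumes "\<mu> \<in> probs P"
  shows "hist_sum \<mu> F n (\<lambda>_ _. k) = k"
proof (induction n)
  case 0
  show ?case
    using sum_integral_obs_lik[OF assms]
    by (simp add: hist_sum_def sum_lists_Suc sum_distrib_right[symmetric])
next
  case (Suc n)
  then show ?case
    by (simp add: hist_sum_Suc sum_distrib_right[symmetric] sum_obs_pred[OF assms])
qed

lemma hist_sum_mono:
  assumes "\<And>ys. length ys = Suc n \<Longrightarrow> f ys (play F n ys) \<le> g ys (play F n ys)"
  shows "hist_sum \<mu> F n f \<le> hist_sum \<mu> F n g"
  unfolding hist_sum_def by (intro sum_mono mult_left_mono hist_prob_nonneg) (use assms in auto)

lemma hist_sum_linear:
  "hist_sum \<mu> F n (\<lambda>ys us. a * f ys us + b * g ys us) = a * hist_sum \<mu> F n f + b * hist_sum \<mu> F n g"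
  by (simp add: hist_sum_def sum.distrib sum_distrib_left algebra_simps)

lemma hist_sum_cong:
  assumes "\<And>ys. length ys = Suc n \<Longrightarrow> play F n ys = play G n ys"
  shows "hist_sum \<mu> F n f = hist_sum \<mu> G n f"
  unfolding hist_sum_def by (rule sum.cong) (use assms in auto)

end

section \<open>Minima over actions, weighted sums and recovery of observations\<close>

lemma Min_range_in: "Min (range (a :: 'u::finite \<Rightarrow> real)) \<in> range a"
  by (rule Min_in) auto

text \<open>With \<open>v\<close> minimising \<open>a\<close> and \<open>w\<close> minimising
  \<open>b\<close>, the difference of the minima lies between \<open>a v - b v\<close> and
  \<open>a w - b w\<close>, so one of these two actions serves.\<close>

lemma abs_Min_range_diff:
  fixes a b :: "'u::finite \<Rightarrow> real"
  obtains u where "\<bar>Min (range a) - Min (range b)\<bar> \<le> \<bar>a u - b u\<bar>"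
proof -
  obtain v w where v: "Min (range a) = a v" and w: "Min (range b) = b w"
    using Min_range_in[of a] Min_range_in[of b] by blast
  have "Min (range a) \<le> a w" "Min (range b) \<le> b v" by simp_all
  with v w have "\<bar>Min (range a) - Min (range b)\<bar> \<le> \<bar>a v - b v\<bar> \<or>
      \<bar>Min (range a) - Min (range b)\<bar> \<le> \<bar>a w - b w\<bar>"
    by linarith
  then show thesis using that by blast
qed

lemma convex_sum_abs_le:
  fixes f p :: "'i \<Rightarrow> real"
  assumes "\<And>i. i \<in> I \<Longrightarrow> \<bar>f i\<bar> \<le> K" "\<And>i. i \<in> I \<Longrightarrow> 0 \<le> p i" "sum p I = 1"
  shows "\<bar>\<Sum>i\<in>I. f i * p i\<bar> \<le> K"
proof -
  have "\<bar>\<Sum>i\<in>I. f i * p i\<bar> \<le> (\<Sum>i\<in>I. K * p i)"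
    by (rule order_trans[OF sum_abs sum_mono]) (use assms in \<open>auto simp: abs_mult intro: mult_right_mono\<close>)
  then show ?thesis by (simp add: sum_distrib_left[symmetric] assms(3))
qed

primrec obs_of :: "nat \<Rightarrow> (nat \<Rightarrow> ('x, 'y, 'u) zstate) \<Rightarrow> 'y list" where
  "obs_of 0 h = fst (snd (h 0))"
| "obs_of (Suc t) h = obs_of t h @ [last (fst (snd (h (Suc t))))]"

text \<open>Consecutive windows are shifted by one, so each later window adds exactly one
  observation, its last, to those of the first.\<close>

lemma obs_of_zhat:
  assumes "\<And>i. i \<le> t \<Longrightarrow> h i = zhat N P \<mu> ys us i" "Suc (t + N) \<le> length ys"
  shows "obs_of t h = take (Suc (t + N)) ys"
  using assms
proof (induction t)
  case (Suc t)
  have "last (take (Suc N) (drop (Suc t) ys)) = ys ! (Suc t + N)"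
    using Suc.prems by (simp add: take_Suc_conv_app_nth)
  with Suc show ?case by (simp add: zhat_def take_Suc_conv_app_nth[of "Suc (t + N)"])
qed (simp add: zhat_def)

section \<open>Comparison of the value functions\<close>

context pomdp_model
begin

section \<open>Bounds for costs and total variation\<close>

lemma St_nonempty: "St P \<noteq> {}"
  using prob_space.not_empty[of "fallback P"] probs_space[OF fallback_in_probs] fallback_in_probs
  by (simp add: probs_iff)

lemma abs_cost_le: "x \<in> St P \<Longrightarrow> \<bar>cost P x u\<bar> \<le> cost_norm P"
proof -
  assume x: "x \<in> St P"
  obtain K where "\<forall>x\<in>St P. \<forall>u. \<bar>cost P x u\<bar> \<le> K"
    using is_pomdp by (auto simp: is_pomdp_def)
  then have "bdd_above ((\<lambda>(x, u). \<bar>cost P x u\<bar>) ` (St P \<times> UNIV))"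
    by (auto intro!: bdd_aboveI[of _ K])
  from cSUP_upper[OF _ this, of "(x, u)"] x show ?thesis by (simp add: cost_norm_def)
qed

lemma cost_norm_nonneg: "0 \<le> cost_norm P"
  using St_nonempty abs_cost_le by (metis abs_ge_zero equals0I order_trans)

text \<open>Shows that the set under the supremum in \<open>tv\<close> is bounded above, without
  which \<open>cSUP_upper\<close> would not apply.\<close>

lemma integral_diff_le_2:
  fixes f :: "'x \<Rightarrow> real"
  assumes "\<mu> \<in> probs P" "\<nu> \<in> probs P" "f \<in> borel_measurable (SX P)" "\<forall>x\<in>space (SX P). \<bar>f x\<bar> \<le> 1"
  shows "\<bar>(\<integral>x. f x \<partial>\<mu>) - (\<integral>x. f x \<partial>\<nu>)\<bar> \<le> 2"
  using probs_integral_bound[OF assms(1,3), of 1] probs_integral_bound[OF assms(2,3), of 1] assms(4)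
  by (auto simp: space_SX)

lemma integral_diff_le_tv_1:
  fixes f :: "'x \<Rightarrow> real"
  assumes "\<mu> \<in> probs P" "\<nu> \<in> probs P" "f \<in> borel_measurable (SX P)" "\<forall>x\<in>space (SX P). \<bar>f x\<bar> \<le> 1"
  shows "\<bar>(\<integral>x. f x \<partial>\<mu>) - (\<integral>x. f x \<partial>\<nu>)\<bar> \<le> tv (SX P) \<mu> \<nu>"
  unfolding tv_def
  by (rule cSUP_upper) (use assms integral_diff_le_2 in \<open>auto intro!: bdd_aboveI[of _ 2]\<close>)

lemma tv_nonneg: "\<mu> \<in> probs P \<Longrightarrow> \<nu> \<in> probs P \<Longrightarrow> 0 \<le> tv (SX P) \<mu> \<nu>"
  using integral_diff_le_tv_1[of \<mu> \<nu> "\<lambda>_. 0"] by simp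

lemma tv_le_2: "\<mu> \<in> probs P \<Longrightarrow> \<nu> \<in> probs P \<Longrightarrow> tv (SX P) \<mu> \<nu> \<le> 2"
  unfolding tv_def by (rule cSUP_least) (auto intro: integral_diff_le_2 exI[of _ "\<lambda>_. 0"])

text \<open>Dividing \<open>f\<close> by \<open>K\<close> makes it a test function for
  \<open>tv\<close>. For \<open>K = 0\<close> both integrals vanish.\<close>

lemma integral_diff_le_tv:
  fixes f :: "'x \<Rightarrow> real"
  assumes "\<mu> \<in> probs P" "\<nu> \<in> probs P" "f \<in> borel_measurable (SX P)" "\<And>x. x \<in> St P \<Longrightarrow> \<bar>f x\<bar> \<le> K"
  shows "\<bar>(\<integral>x. f x \<partial>\<mu>) - (\<integral>x. f x \<partial>\<nu>)\<bar> \<le> K * tv (SX P) \<mu> \<nu>"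
proof (cases "K = 0")
  case True
  then show ?thesis
    using probs_integral_bound[OF assms(1,3,4)] probs_integral_bound[OF assms(2,3,4)] by simp
next
  case False
  moreover have "0 \<le> K"
    using probs_integral_bound[OF assms(1,3,4)] by (meson abs_ge_zero order_trans)
  ultimately have K: "0 < K" by simp
  have "\<bar>(\<integral>x. f x / K \<partial>\<mu>) - (\<integral>x. f x / K \<partial>\<nu>)\<bar> \<le> tv (SX P) \<mu> \<nu>"
    using K assms by (intro integral_diff_le_tv_1) (auto simp: space_SX)
  then show ?thesis
    using K by (simp add: diff_divide_distrib[symmetric] abs_divide pos_divide_le_eq mult.commute)
qed

section \<open>One step of the belief-MDP\<close>

lemma in_space_Zhat:
  "(\<pi>, ys, us) \<in> space (Zhat N P) \<longleftrightarrow> \<pi> \<in> probs P \<and> length ys = Suc N \<and> length us = N"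
  by (auto simp: Zhat_def space_pair_measure probs_def)

definition zstep :: "('x, 'y, 'u) zstate \<Rightarrow> 'u \<Rightarrow> 'y \<Rightarrow> ('x, 'y, 'u) zstate" where
  "zstep = (\<lambda>(\<pi>, ys, us) u y. (predict P \<pi> (hd ys) (hd (us @ [u])), tl (ys @ [y]), tl (us @ [u])))"

lemma zhat_in_Zhat:
  assumes "\<mu> \<in> probs P" "length ys = Suc (t + N)" "length us = t + N"
  shows "zhat N P \<mu> ys us t \<in> space (Zhat N P)"
  using assms by (simp add: zhat_def in_space_Zhat predictor_in_probs)

lemma posterior_in_probs: "\<pi> \<in> probs P \<Longrightarrow> posterior N P (\<pi>, w) \<in> probs P"
  by (cases w) (simp add: posterior_def filt_in_probs)

lemma abs_cost_hat_le: "\<pi> \<in> probs P \<Longrightarrow> \<bar>cost_hat N P (\<pi>, w) u\<bar> \<le> cost_norm P"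
  unfolding cost_hat_def
  by (rule probs_integral_bound[OF posterior_in_probs cost_measurable abs_cost_le])

lemma next_obs_nonneg: "0 \<le> next_obs N P z u y"
  by (cases z) (simp add: next_obs_def obs_pred_nonneg)

lemma sum_next_obs: "\<pi> \<in> probs P \<Longrightarrow> (\<Sum>y\<in>UNIV. next_obs N P (\<pi>, w) u y) = 1"
  by (cases w) (simp add: next_obs_def sum_obs_pred)

text \<open>The prior influences the law of the next observation only through the posterior at the
  end of the window, so the distance of the posteriors controls the change of this law.\<close>

lemma next_obs_eq_posterior:
  assumes "length us = N"
  shows "next_obs N P (\<pi>, ys, us) u y =
    (\<integral>x. (\<integral>x'. obs_lik P y x' \<partial>Tr P x u) \<partial>posterior N P (\<pi>, ys, us))"
proof -
  have "filt P \<pi> (nth ys) (nth (us @ [u])) N = filt P \<pi> (nth ys) (nth us) N"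
    using assms by (intro filt_cong) (auto simp: nth_append)
  with assms show ?thesis
    by (simp add: next_obs_def obs_pred_def posterior_def nth_append)
qed

text \<open>Exchanging sum and integral turns each weighted sum into the integral of the single
  function \<open>?g\<close>. As a convex combination of the \<open>w y\<close> it is bounded by
  \<open>K\<close>, so no factor counting the observations appears.\<close>

lemma next_obs_diff_le_tv:
  assumes "\<pi> \<in> probs P" "\<pi>' \<in> probs P" "length us = N" "\<And>y. \<bar>w y\<bar> \<le> K"
  shows "\<bar>\<Sum>y\<in>UNIV. w y * (next_obs N P (\<pi>, ys, us) u y - next_obs N P (\<pi>', ys, us) u y)\<bar>
    \<le> K * tv (SX P) (posterior N P (\<pi>, ys, us)) (posterior N P (\<pi>', ys, us))"
proof -
  let ?q = "\<lambda>y x. \<integral>x'. obs_lik P y x' \<partial>Tr P x u"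
  let ?g = "\<lambda>x. \<Sum>y\<in>UNIV. w y * ?q y x"
  have q: "\<bar>?q y x\<bar> \<le> 1" if "x \<in> St P" for x y
    using that by (auto intro!: probs_integral_bound Tr_in_probs obs_lik_abs)
  have expand: "(\<integral>x. ?g x \<partial>posterior N P (\<rho>, ys, us)) = (\<Sum>y\<in>UNIV. w y * next_obs N P (\<rho>, ys, us) u y)"
    if "\<rho> \<in> probs P" for \<rho>
  proof -
    have "integrable (posterior N P (\<rho>, ys, us)) (?q y)" for y
      by (rule probs_integrable[OF posterior_in_probs[OF that] _ q]) simp
    then show ?thesis
      by (simp add: Bochner_Integration.integral_sum next_obs_eq_posterior[OF assms(3)])
  qed
  have "\<bar>?g x\<bar> \<le> K" if "x \<in> St P" for x
    using that assms(4)
    by (intro convex_sum_abs_le) (auto simp: integral_obs_lik_nonneg sum_integral_obs_lik Tr_in_probs)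
  from integral_diff_le_tv[OF posterior_in_probs[OF assms(1)] posterior_in_probs[OF assms(2)] _ this]
  have "\<bar>(\<integral>x. ?g x \<partial>posterior N P (\<pi>, ys, us)) - (\<integral>x. ?g x \<partial>posterior N P (\<pi>', ys, us))\<bar>
    \<le> K * tv (SX P) (posterior N P (\<pi>, ys, us)) (posterior N P (\<pi>', ys, us))"
    by simp
  then show ?thesis
    unfolding expand[OF assms(1)] expand[OF assms(2)] by (simp add: sum_subtractf right_diff_distrib)
qed

text \<open>There are finitely many windows, so the absolute value attains its maximum
  \<open>M\<close>. The Bellman equation at a maximising window gives
  \<open>M \<le> cost_norm P + \<beta> * M\<close>.\<close>

lemma approx_value_bound:
  assumes \<pi>s: "\<pi>s \<in> probs P" and JN: "is_approx_value_function N P \<pi>s JN"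
    and "length ys = Suc N" "length us = N"
  shows "\<bar>JN (\<pi>s, ys, us)\<bar> \<le> cost_norm P / (1 - \<beta>)"
proof -
  let ?W = "{ys :: 'y list. length ys = Suc N} \<times> {us :: 'u list. length us = N}"
  let ?f = "\<lambda>w. \<bar>JN (\<pi>s, w)\<bar>"
  have fin: "finite ?W"
    using finite_lists_length_eq[of "UNIV :: 'y set" "Suc N"] finite_lists_length_eq[of "UNIV :: 'u set" N]
    by simp
  define M where "M = Max (?f ` ?W)"
  have le_M: "?f w \<le> M" if "w \<in> ?W" for w
    unfolding M_def using fin that by simp
  have w: "(ys, us) \<in> ?W" using assms by simp
  then have "M \<in> ?f ` ?W"
    unfolding M_def using fin by (intro Max_in) auto
  then obtain ys' us' where len: "length ys' = Suc N" "length us' = N" and M: "M = \<bar>JN (\<pi>s, ys', us')\<bar>"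
    by auto
  define Q where "Q u = cost_hat N P (\<pi>s, ys', us') u + \<beta> * (\<Sum>y\<in>UNIV.
      JN (\<pi>s, tl (ys' @ [y]), tl (us' @ [u])) * next_obs N P (\<pi>s, ys', us') u y)" for u
  have "JN (\<pi>s, ys', us') = Min (range Q)"
    unfolding Q_def by (rule JN[unfolded is_approx_value_function_def, rule_format]) (simp_all add: len)
  then obtain u where u: "JN (\<pi>s, ys', us') = Q u"
    using Min_range_in[of Q] by (metis imageE)
  have "\<bar>\<Sum>y\<in>UNIV. JN (\<pi>s, tl (ys' @ [y]), tl (us' @ [u])) * next_obs N P (\<pi>s, ys', us') u y\<bar> \<le> M"
    by (intro convex_sum_abs_le le_M) (auto simp: len next_obs_nonneg sum_next_obs \<pi>s)
  then have "\<beta> * \<bar>\<Sum>y\<in>UNIV. JN (\<pi>s, tl (ys' @ [y]), tl (us' @ [u])) * next_obs N P (\<pi>s, ys', us') u y\<bar> \<le> \<beta> * M"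
    using disc_pos by (intro mult_left_mono) auto
  moreover have "\<bar>Q u\<bar> \<le> \<bar>cost_hat N P (\<pi>s, ys', us') u\<bar>
      + \<beta> * \<bar>\<Sum>y\<in>UNIV. JN (\<pi>s, tl (ys' @ [y]), tl (us' @ [u])) * next_obs N P (\<pi>s, ys', us') u y\<bar>"
    unfolding Q_def using disc_pos by (intro order_trans[OF abs_triangle_ineq]) (simp add: abs_mult)
  ultimately have "M \<le> cost_norm P + \<beta> * M"
    using abs_cost_hat_le[OF \<pi>s, of N "(ys', us')" u] M u by linarith
  then have "M * (1 - \<beta>) \<le> cost_norm P" by (simp add: algebra_simps)
  then have "M \<le> cost_norm P / (1 - \<beta>)"
    using disc_less_1 by (simp add: pos_le_divide_eq)
  with le_M[OF w] show ?thesis by simp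
qed

definition post_err :: "nat \<Rightarrow> 'x measure \<Rightarrow> ('x, 'y, 'u) zstate \<Rightarrow> real" where
  "post_err N \<pi>s = (\<lambda>(\<pi>, ys, us). tv (SX P) (posterior N P (\<pi>, ys, us)) (posterior N P (\<pi>s, ys, us)))"

lemma post_err_nonneg: "\<pi>s \<in> probs P \<Longrightarrow> fst z \<in> probs P \<Longrightarrow> 0 \<le> post_err N \<pi>s z"
  by (cases z) (simp add: post_err_def tv_nonneg posterior_in_probs)

lemma post_err_le_2: "\<pi>s \<in> probs P \<Longrightarrow> fst z \<in> probs P \<Longrightarrow> post_err N \<pi>s z \<le> 2"
  by (cases z) (simp add: post_err_def tv_le_2 posterior_in_probs)

text \<open>The action comes from \<open>abs_Min_range_diff\<close> and depends on \<open>z\<close>.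
  The averaged error on the right uses the true observation law of this one action, so it becomes a
  true expectation once the action is played.\<close>

lemma value_error_step:
  fixes N \<pi>s Js JN
  defines "e \<equiv> \<lambda>z. \<bar>extend_value \<pi>s JN z - Js z\<bar>"
  assumes \<pi>s: "\<pi>s \<in> probs P" and Js: "is_value_function N P Js"
    and JN: "is_approx_value_function N P \<pi>s JN" and z: "z \<in> space (Zhat N P)"
  shows "\<exists>u. e z \<le> cost_norm P / (1 - \<beta>) * post_err N \<pi>s z
    + \<beta> * (\<Sum>y\<in>UNIV. next_obs N P z u y * e (zstep z u y))"
proof -
  obtain \<pi> ys us where z_eq: "z = (\<pi>, ys, us)" by (cases z)
  with z have \<pi>: "\<pi> \<in> probs P" and len: "length ys = Suc N" "length us = N"
    by (simp_all add: in_space_Zhat)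
  define C where "C = cost_norm P / (1 - \<beta>)"
  define w where "w u y = JN (\<pi>s, tl (ys @ [y]), tl (us @ [u]))" for u y
  define v where "v u y = Js (zstep z u y)" for u y
  define q where "q \<rho> = next_obs N P (\<rho>, ys, us)" for \<rho>
  define T where "T = post_err N \<pi>s z"
  define a where "a u = cost_hat N P (\<pi>s, ys, us) u + \<beta> * (\<Sum>y\<in>UNIV. w u y * q \<pi>s u y)" for u
  define b where "b u = cost_hat N P (\<pi>, ys, us) u + \<beta> * (\<Sum>y\<in>UNIV. v u y * q \<pi> u y)" for u
  have "JN (\<pi>s, ys, us) = Min (range a)"
    unfolding a_def w_def q_def
    by (rule JN[unfolded is_approx_value_function_def, rule_format]) (simp_all add: len)
  moreover have "Js z = Min (range b)"
    unfolding b_def v_def q_def z_eq zstep_def prod.case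
    by (rule Js[unfolded is_value_function_def, THEN conjunct2, rule_format]) (use z in \<open>simp add: z_eq\<close>)
  moreover obtain u where "\<bar>Min (range a) - Min (range b)\<bar> \<le> \<bar>a u - b u\<bar>"
    by (rule abs_Min_range_diff)
  ultimately have e_le: "e z \<le> \<bar>a u - b u\<bar>"
    by (simp add: e_def z_eq extend_value_def)
  have "\<bar>cost_hat N P (\<pi>, ys, us) u - cost_hat N P (\<pi>s, ys, us) u\<bar> \<le> cost_norm P * T"
    unfolding cost_hat_def T_def z_eq post_err_def prod.case
    by (rule integral_diff_le_tv) (auto intro: posterior_in_probs \<pi> \<pi>s abs_cost_le)
  moreover have "\<bar>\<Sum>y\<in>UNIV. w u y * (q \<pi> u y - q \<pi>s u y)\<bar> \<le> C * T"
    unfolding q_def T_def z_eq post_err_def prod.case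
    by (rule next_obs_diff_le_tv[OF \<pi> \<pi>s len(2)])
      (simp add: w_def C_def approx_value_bound[OF \<pi>s JN] len)
  then have "\<beta> * \<bar>\<Sum>y\<in>UNIV. w u y * (q \<pi> u y - q \<pi>s u y)\<bar> \<le> \<beta> * (C * T)"
    using disc_pos by (intro mult_left_mono) auto
  \<comment> \<open>\<open>extend_value\<close> replaces the belief coordinate by
    \<open>\<pi>s\<close>, so \<open>w u y\<close> is the extended approximate value at
    \<open>zstep z u y\<close>.\<close>
  moreover have "\<bar>\<Sum>y\<in>UNIV. (w u y - v u y) * q \<pi> u y\<bar> \<le> (\<Sum>y\<in>UNIV. q \<pi> u y * e (zstep z u y))"
    by (rule order_trans[OF sum_abs sum_mono])
      (simp add: abs_mult q_def next_obs_nonneg e_def w_def v_def z_eq zstep_def extend_value_def mult.commute)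
  then have "\<beta> * \<bar>\<Sum>y\<in>UNIV. (w u y - v u y) * q \<pi> u y\<bar> \<le> \<beta> * (\<Sum>y\<in>UNIV. q \<pi> u y * e (zstep z u y))"
    using disc_pos by (intro mult_left_mono) auto
  \<comment> \<open>The mixed term, approximate values \<open>w\<close> under the true law
    \<open>q \<pi>\<close>, is inserted: one gap then compares laws under equal values, the other
    compares values under equal laws.\<close>
  moreover have "a u - b u = - (cost_hat N P (\<pi>, ys, us) u - cost_hat N P (\<pi>s, ys, us) u)
      - \<beta> * (\<Sum>y\<in>UNIV. w u y * (q \<pi> u y - q \<pi>s u y)) + \<beta> * (\<Sum>y\<in>UNIV. (w u y - v u y) * q \<pi> u y)"
    by (simp add: a_def b_def sum_subtractf algebra_simps)
  then have "\<bar>a u - b u\<bar> \<le> \<bar>cost_hat N P (\<pi>, ys, us) u - cost_hat N P (\<pi>s, ys, us) u\<bar>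
      + \<beta> * \<bar>\<Sum>y\<in>UNIV. w u y * (q \<pi> u y - q \<pi>s u y)\<bar> + \<beta> * \<bar>\<Sum>y\<in>UNIV. (w u y - v u y) * q \<pi> u y\<bar>"
    using abs_mult[of \<beta>] disc_pos by (smt (verit, best))
  moreover have "cost_norm P * T + \<beta> * (C * T) = C * T"
    using disc_less_1 by (simp add: C_def field_simps)
  ultimately have "e z \<le> C * T + \<beta> * (\<Sum>y\<in>UNIV. q \<pi> u y * e (zstep z u y))"
    using e_le by linarith
  then show ?thesis unfolding C_def T_def q_def z_eq by blast
qed

text \<open>The horizon \<open>T\<close> stays fixed while \<open>t\<close> grows, so that the
  induction remains on one product space; \<open>t \<le> T\<close> keeps the coordinates that are
  read inside it.\<close>

lemma obs_of_measurable:
  assumes "t \<le> T"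
  shows "obs_of t \<in> (\<Pi>\<^sub>M i\<in>{..T}. Zhat N P) \<rightarrow>\<^sub>M count_space UNIV"
proof -
  have window: "(\<lambda>h. fst (snd (h i))) \<in> (\<Pi>\<^sub>M i\<in>{..T}. Zhat N P) \<rightarrow>\<^sub>M count_space UNIV" if "i \<le> T" for i
  proof -
    have "(\<lambda>z. fst (snd z)) \<in> Zhat N P \<rightarrow>\<^sub>M count_space {ys. length ys = N + 1}"
      unfolding Zhat_def by measurable
    from measurable_compose[OF this, of "\<lambda>ys. ys" "count_space UNIV"]
    have "(\<lambda>z. fst (snd z)) \<in> Zhat N P \<rightarrow>\<^sub>M count_space UNIV" by simp
    from measurable_compose[OF measurable_component_singleton[of i "{..T}" "\<lambda>_. Zhat N P"] this] that
    show ?thesis by simp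
  qed
  show ?thesis using assms
  proof (induction t)
    case 0
    show ?case using window[of 0] by simp
  next
    case (Suc t)
    then have "(\<lambda>h. (obs_of t h, fst (snd (h (Suc t))))) \<in> (\<Pi>\<^sub>M i\<in>{..T}. Zhat N P)
        \<rightarrow>\<^sub>M count_space UNIV \<Otimes>\<^sub>M count_space UNIV"
      by (intro measurable_Pair window) auto
    then have "(\<lambda>h. (obs_of t h, fst (snd (h (Suc t))))) \<in> (\<Pi>\<^sub>M i\<in>{..T}. Zhat N P) \<rightarrow>\<^sub>M count_space UNIV"
      by (subst (asm) pair_measure_countable) auto
    from measurable_compose[OF this, of "\<lambda>(ys, w). ys @ [last w]" "count_space UNIV"]
    show ?case by simp
  qed
qed

text \<open>The policy recovers the past observations from the windows and replays its own past actions
  (which the windows do not contain for \<open>N = 0\<close>), so only functions on countable discrete spaces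
  occur and \<open>best\<close> need not be measurable.\<close>

lemma policy_of_choice:
  fixes N \<mu> \<eta> and best :: "('x, 'y, 'u) zstate \<Rightarrow> 'u"
  defines "F \<equiv> \<lambda>ys us. if length us < N then \<eta> ys us else best (zhat N P \<mu> ys us (length us - N))"
  obtains \<gamma> where "\<gamma> \<in> policies N P"
    "\<And>n f. hist_sum \<mu> (act N P \<mu> \<gamma>) n f = hist_sum \<mu> F n f"
proof
  define \<kappa> where "\<kappa> t h = best (zhat N P \<mu> (obs_of t h) (play F (t + N) (obs_of t h)) t)"
    for t and h :: "nat \<Rightarrow> ('x, 'y, 'u) zstate"
  have "\<kappa> t \<in> (\<Pi>\<^sub>M i\<in>{..t}. Zhat N P) \<rightarrow>\<^sub>M count_space UNIV" for t
    unfolding \<kappa>_def by (rule measurable_compose[OF obs_of_measurable[OF order_refl]]) simp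
  then show "(\<eta>, \<kappa>) \<in> policies N P"
    by (simp add: policies_def)
  fix n f
  show "hist_sum \<mu> (act N P \<mu> (\<eta>, \<kappa>)) n f = hist_sum \<mu> F n f"
  \<comment> \<open>The symmetric form tests the rules on histories generated by \<open>F\<close>,
    where the actions replayed by \<open>\<kappa>\<close> are the ones actually taken.\<close>
  proof (rule hist_sum_cong, rule play_cong[symmetric])
    fix ys :: "'y list" and m
    assume len: "length ys = Suc n" and m: "m < n"
    show "F (take (Suc m) ys) (play F m ys) = act N P \<mu> (\<eta>, \<kappa>) (take (Suc m) ys) (play F m ys)"
    proof (cases "m < N")
      case False
      define h where "h = (\<lambda>i\<in>{..m - N}. zhat N P \<mu> (take (Suc m) ys) (play F m ys) i)"
      have "obs_of (m - N) h = take (Suc (m - N + N)) (take (Suc m) ys)"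
        by (rule obs_of_zhat[of _ _ _ P \<mu> _ "play F m ys"]) (use len m False in \<open>auto simp: h_def\<close>)
      then have obs: "obs_of (m - N) h = take (Suc m) ys" using False by simp
      \<comment> \<open>The first \<open>m\<close> actions are unaffected by cutting off
        observations after time \<open>m\<close>.\<close>
      have "play F m (take (Suc m) ys) = play F m ys"
        using play_append[of m "take (Suc m) ys" F "drop (Suc m) ys"] len m by simp
      with False have "\<kappa> (m - N) h = best (zhat N P \<mu> (take (Suc m) ys) (play F m ys) (m - N))"
        unfolding \<kappa>_def obs by simp
      moreover have "act N P \<mu> (\<eta>, \<kappa>) (take (Suc m) ys) (play F m ys) = \<kappa> (m - N) h"
        using False by (simp add: act_def h_def)
      moreover have "F (take (Suc m) ys) us = best (zhat N P \<mu> (take (Suc m) ys) us (m - N))"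
        if "length us = m" for us
        using that False by (simp add: F_def)
      ultimately show ?thesis by simp
    qed (simp add: F_def act_def)
  qed
qed

text \<open>The values of \<open>tv\<close> lie between 0 and 2 and the history weights sum to one,
  so the supremum is over a bounded set. A given policy ensures that this set is nonempty. The
  uniform bound later yields summability.\<close>

lemma filter_err_bounds:
  assumes \<mu>: "\<mu> \<in> probs P" and \<pi>s: "\<pi>s \<in> probs P"
  shows hist_sum_le_filter_err: "\<gamma> \<in> policies N P \<Longrightarrow>
      hist_sum \<mu> (act N P \<mu> \<gamma>) (t + N) (\<lambda>ys us. post_err N \<pi>s (zhat N P \<mu> ys us t)) \<le> filter_err N P \<mu> \<pi>s t"
    and filter_err_nonneg: "\<gamma> \<in> policies N P \<Longrightarrow> 0 \<le> filter_err N P \<mu> \<pi>s t"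
    and filter_err_le_2: "\<gamma> \<in> policies N P \<Longrightarrow> filter_err N P \<mu> \<pi>s t \<le> 2"
proof -
  let ?f = "\<lambda>ys us. post_err N \<pi>s (zhat N P \<mu> ys us t)"
  let ?h = "\<lambda>\<gamma>. hist_sum \<mu> (act N P \<mu> \<gamma>) (t + N) ?f"
  have z: "fst (zhat N P \<mu> ys us t) \<in> probs P" for ys us
    by (simp add: zhat_def predictor_in_probs[OF \<mu>])
  have "expect N P \<mu> \<gamma> (t + N) ?f = ?h \<gamma>" for \<gamma>
    by (rule expect_eq_hist_sum[OF \<mu>]) (rule post_err_nonneg[OF \<pi>s z])
  then have err: "filter_err N P \<mu> \<pi>s t = (SUP \<gamma>\<in>policies N P. ?h \<gamma>)"
    unfolding filter_err_def by (simp add: post_err_def)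
  have le_2: "?h \<gamma> \<le> 2" for \<gamma>
    using hist_sum_mono[of "t + N" ?f "act N P \<mu> \<gamma>" "\<lambda>_ _. 2" \<mu>] post_err_le_2[OF \<pi>s z]
    by (simp add: hist_sum_const[OF \<mu>])
  have nonneg: "0 \<le> ?h \<gamma>" for \<gamma>
    using hist_sum_mono[of "t + N" "\<lambda>_ _. 0" "act N P \<mu> \<gamma>" ?f \<mu>] post_err_nonneg[OF \<pi>s z]
    by (simp add: hist_sum_const[OF \<mu>])
  show upper: "?h \<gamma> \<le> filter_err N P \<mu> \<pi>s t" if "\<gamma> \<in> policies N P" for \<gamma>
    unfolding err by (rule cSUP_upper[OF that]) (auto intro: bdd_aboveI le_2)
  show "0 \<le> filter_err N P \<mu> \<pi>s t" if "\<gamma> \<in> policies N P" for \<gamma>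
    using upper[OF that] nonneg order_trans by blast
  show "filter_err N P \<mu> \<pi>s t \<le> 2" if "\<gamma> \<in> policies N P" for \<gamma>
    unfolding err by (rule cSUP_least) (use that le_2 in auto)
qed

section \<open>Iteration of the one-step inequality along a policy\<close>

lemma value_error_bound:
  fixes N \<mu> \<pi>s Js JN
  defines "e \<equiv> \<lambda>z. \<bar>extend_value \<pi>s JN z - Js z\<bar>"
  assumes \<mu>: "\<mu> \<in> probs P" and \<pi>s: "\<pi>s \<in> probs P" and Js: "is_value_function N P Js"
    and JN: "is_approx_value_function N P \<pi>s JN" and \<gamma>: "\<gamma> \<in> policies N P"
  shows "expect N P \<mu> \<gamma> N (\<lambda>ys us. e (zhat N P \<mu> ys us 0))
    \<le> cost_norm P / (1 - \<beta>) * (\<Sum>t. \<beta> ^ t * filter_err N P \<mu> \<pi>s t)"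
proof -
  let ?C = "cost_norm P / (1 - \<beta>)"
  let ?L = "filter_err N P \<mu> \<pi>s"
  obtain \<eta> \<kappa> where \<gamma>_eq: "\<gamma> = (\<eta>, \<kappa>)" by (cases \<gamma>)
  have "\<forall>z\<in>space (Zhat N P). \<exists>u. e z \<le> ?C * post_err N \<pi>s z
      + \<beta> * (\<Sum>y\<in>UNIV. next_obs N P z u y * e (zstep z u y))"
    unfolding e_def by (intro ballI value_error_step[OF \<pi>s Js JN])
  \<comment> \<open>This selection carries no measurability; \<open>policy_of_choice\<close>
    supplies an admissible policy with the same history sums.\<close>
  from bchoice[OF this] obtain best where best: "e z \<le> ?C * post_err N \<pi>s z
      + \<beta> * (\<Sum>y\<in>UNIV. next_obs N P z (best z) y * e (zstep z (best z) y))"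
    if "z \<in> space (Zhat N P)" for z
    by blast
  \<comment> \<open>Before time \<open>N\<close> the actions are still those of
    \<open>\<gamma>\<close>, so the law of the initial window is unchanged.\<close>
  define F where "F = (\<lambda>ys us. if length us < N then \<eta> ys us
    else best (zhat N P \<mu> ys us (length us - N)))"
  obtain \<gamma>' where \<gamma>': "\<gamma>' \<in> policies N P"
    and F: "\<And>n f. hist_sum \<mu> (act N P \<mu> \<gamma>') n f = hist_sum \<mu> F n f"
    by (rule policy_of_choice[of N \<mu> \<eta> best], rule that, assumption, simp only: F_def)
  define E where "E t = hist_sum \<mu> F (t + N) (\<lambda>ys us. e (zhat N P \<mu> ys us t))" for t
  have C_nonneg: "0 \<le> ?C" using cost_norm_nonneg disc_less_1 by simp
  have E_step: "E t \<le> ?C * ?L t + \<beta> * E (Suc t)" for t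
  proof -
    have "E t \<le> hist_sum \<mu> F (t + N) (\<lambda>ys us. ?C * post_err N \<pi>s (zhat N P \<mu> ys us t)
      + \<beta> * (\<Sum>y\<in>UNIV. obs_pred P \<mu> (nth ys) (nth (us @ [F ys us])) (t + N) y
          * e (zhat N P \<mu> (ys @ [y]) (us @ [F ys us]) (Suc t))))"
      unfolding E_def
    proof (rule hist_sum_mono)
      fix ys :: "'y list" assume len: "length ys = Suc (t + N)"
      let ?us = "play F (t + N) ys"
      let ?z = "zhat N P \<mu> ys ?us t"
      have F_eq: "F ys ?us = best ?z" by (simp add: F_def)
      have "zstep ?z (best ?z) y = zhat N P \<mu> (ys @ [y]) (?us @ [best ?z]) (Suc t)" for y
        using len by (subst zhat_snoc) (simp_all add: zstep_def split_beta')
      moreover have "next_obs N P ?z (best ?z) y = obs_pred P \<mu> (nth ys) (nth (?us @ [best ?z])) (t + N) y" for y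
        using len by (intro next_obs_zhat) simp_all
      ultimately show "e ?z \<le> ?C * post_err N \<pi>s ?z
        + \<beta> * (\<Sum>y\<in>UNIV. obs_pred P \<mu> (nth ys) (nth (?us @ [F ys ?us])) (t + N) y
            * e (zhat N P \<mu> (ys @ [y]) (?us @ [F ys ?us]) (Suc t)))"
        using best[OF zhat_in_Zhat[OF \<mu> len, of ?us]] unfolding F_eq by simp
    qed
    \<comment> \<open>Read from right to left, the tower property collects the averaged errors at
      the successor states into \<open>E (Suc t)\<close>.\<close>
    also have "\<dots> = ?C * hist_sum \<mu> F (t + N) (\<lambda>ys us. post_err N \<pi>s (zhat N P \<mu> ys us t)) + \<beta> * E (Suc t)"
      unfolding E_def add_Suc hist_sum_Suc by (rule hist_sum_linear)
    also have "\<dots> \<le> ?C * ?L t + \<beta> * E (Suc t)"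
      using hist_sum_le_filter_err[OF \<mu> \<pi>s \<gamma>', of t] C_nonneg
      by (intro add_right_mono mult_left_mono) (simp_all add: F)
    finally show ?thesis .
  qed
  have iterate: "E 0 \<le> ?C * (\<Sum>t<T. \<beta> ^ t * ?L t) + \<beta> ^ T * E T" for T
  proof (induction T)
    case (Suc T)
    have "\<beta> ^ T * E T \<le> \<beta> ^ T * (?C * ?L T + \<beta> * E (Suc T))"
      using disc_pos by (intro mult_left_mono E_step) simp
    with Suc show ?case by (simp add: algebra_simps)
  qed simp
  obtain K where K: "\<And>z. z \<in> space (Zhat N P) \<Longrightarrow> \<bar>Js z\<bar> \<le> K"
    using Js unfolding is_value_function_def by blast
  \<comment> \<open>A bound independent of \<open>t\<close>: \<open>?C\<close> for the approximate
    values and \<open>K\<close> for the true ones. It makes the remainder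
    \<open>\<beta> ^ T * E T\<close> vanish.\<close>
  have E_bound: "E t \<le> ?C + K" for t
  proof -
    have "E t \<le> hist_sum \<mu> F (t + N) (\<lambda>_ _. ?C + K)"
      unfolding E_def
    proof (rule hist_sum_mono)
      fix ys :: "'y list" assume len: "length ys = Suc (t + N)"
      let ?z = "zhat N P \<mu> ys (play F (t + N) ys) t"
      have "\<bar>extend_value \<pi>s JN ?z\<bar> \<le> ?C"
        using len by (simp add: zhat_def extend_value_def approx_value_bound[OF \<pi>s JN])
      moreover have "\<bar>Js ?z\<bar> \<le> K"
        using len by (intro K zhat_in_Zhat[OF \<mu>]) simp_all
      ultimately show "e ?z \<le> ?C + K" unfolding e_def by linarith
    qed
    then show ?thesis by (simp add: hist_sum_const[OF \<mu>])
  qed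
  \<comment> \<open>Comparison with a geometric series; summability is what places the partial sums
    below the infinite sum.\<close>
  have summable: "summable (\<lambda>t. \<beta> ^ t * ?L t)"
  proof (rule summable_comparison_test')
    show "summable (\<lambda>t. \<beta> ^ t * 2)"
      using disc_pos disc_less_1 by (intro summable_mult2 summable_geometric) simp
    show "norm (\<beta> ^ t * ?L t) \<le> \<beta> ^ t * 2" for t
      using filter_err_nonneg[OF \<mu> \<pi>s \<gamma>, of t] filter_err_le_2[OF \<mu> \<pi>s \<gamma>, of t] disc_pos
      by (simp add: abs_mult)
  qed
  have "E 0 \<le> ?C * (\<Sum>t. \<beta> ^ t * ?L t) + \<beta> ^ T * (?C + K)" for T
  proof -
    have "(\<Sum>t<T. \<beta> ^ t * ?L t) \<le> (\<Sum>t. \<beta> ^ t * ?L t)"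
      using filter_err_nonneg[OF \<mu> \<pi>s \<gamma>] disc_pos by (intro sum_le_suminf summable) auto
    moreover have "\<beta> ^ T * E T \<le> \<beta> ^ T * (?C + K)"
      using disc_pos by (intro mult_left_mono E_bound) simp
    ultimately show ?thesis
      using iterate[of T] C_nonneg by (meson add_mono mult_left_mono order_trans)
  qed
  \<comment> \<open>Letting \<open>T\<close> tend to infinity removes the remainder.\<close>
  moreover have "(\<lambda>T. ?C * (\<Sum>t. \<beta> ^ t * ?L t) + \<beta> ^ T * (?C + K))
      \<longlonglongrightarrow> ?C * (\<Sum>t. \<beta> ^ t * ?L t) + 0 * (?C + K)"
    using disc_pos disc_less_1 by (intro tendsto_intros LIMSEQ_realpow_zero) auto
  ultimately have "E 0 \<le> ?C * (\<Sum>t. \<beta> ^ t * ?L t)"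
    by (intro LIMSEQ_le_const[where X = "\<lambda>T. ?C * (\<Sum>t. \<beta> ^ t * ?L t) + \<beta> ^ T * (?C + K)"]) auto
  moreover have "expect N P \<mu> \<gamma> N (\<lambda>ys us. e (zhat N P \<mu> ys us 0)) = E 0"
  proof -
    \<comment> \<open>The history up to time \<open>N\<close> contains only actions at times before
      \<open>N\<close>, where \<open>F\<close> and \<open>\<gamma>\<close> both follow
      \<open>\<eta>\<close>.\<close>
    have "hist_sum \<mu> (act N P \<mu> \<gamma>) N f = hist_sum \<mu> F N f" for f
      by (intro hist_sum_cong play_cong) (simp add: F_def act_def \<gamma>_eq)
    then show ?thesis
      by (subst expect_eq_hist_sum[OF \<mu>]) (simp_all add: E_def e_def)
  qed
  ultimately show ?thesis by simp
qed

end

theorem theorem3p2: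
  fixes P :: "(real ^ 'm, 'y::finite, 'u::finite) pomdp"
    and N :: nat
    and \<pi>0 \<pi>s :: "(real ^ 'm) measure"
    and Jstar JN :: "(real ^ 'm, 'y, 'u) zstate \<Rightarrow> real"
    and \<gamma> :: "(real ^ 'm, 'y, 'u) policy"
  assumes "is_pomdp P"
    and "\<pi>0 \<in> probs P"
    and "\<pi>s \<in> probs P"
    and "is_value_function N P Jstar"
    and "is_approx_value_function N P \<pi>s JN"
    and "\<gamma> \<in> policies N P"
  shows "expect N P \<pi>0 \<gamma> N
           (\<lambda>ys us. \<bar>extend_value \<pi>s JN (zhat N P \<pi>0 ys us 0) - Jstar (zhat N P \<pi>0 ys us 0)\<bar>)
         \<le> cost_norm P / (1 - disc P) * (\<Sum>t. disc P ^ t * filter_err N P \<pi>0 \<pi>s t)"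
proof -
  interpret pomdp_model P by unfold_locales fact
  show ?thesis by (rule value_error_bound[OF assms(2-6)])
qed

end
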